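(* Let $E$ be a nonzero real Banach space and $S\colon E\rightrightarrows E^*$ be maximally monotone. Then the following are equivalent: (a) $S$ is quasidense; (b) $S$ is of type (FP); (c) for all $(w^*,w^{**})\in E^*\times E^{**}$, $\inf_{(s,s^* )\in G(S)}\langle s^*-w^*,\widehat s-w^{**}\rangle\le0$.
   Context: $\widehat s\in E^{**}$ is the canonical image of $s\in E$. $S$ (with nonempty graph $G(S)$ and range $R(S)$) is monotone if $\langle s-t,s^*-t^*\rangle\ge0$ on $G(S)$, maximally monotone if no monotone multifunction has a strictly larger graph; quasidense if for every $(x,x^* )\in E\times E^*$, $\inf_{(s,s^* )\in G(S)}[\tfrac12\|s-x\|^2+\tfrac12\|s^*-x^*\|^2+\langle s-x,s^*-x^*\rangle]\le0$. A monotone $S$ is of type (FP) if whenever $\widetilde U$ is an open convex subset of $E^*$ with $\widetilde U\cap R(S)\ne\emptyset$, $(w,w^* )\in E\times\widetilde U$, and $\langle s-w,s^*-w^*\rangle\ge0$ for all $(s,s^* )\in G(S)$ with $s^*\in\widetilde U$, then $(w,w^* )\in G(S)$. *)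

theory Defs
  imports "HOL-Analysis.Analysis"
begin

(* E is a real Banach space ('a::banach); E* is 'a \<Rightarrow>\<^sub>L real (norm = operator norm),
  E** is ('a \<Rightarrow>\<^sub>L real) \<Rightarrow>\<^sub>L real. A multifunction S : E \<rightrightarrows> E* is represented by its graph. *)

definition canon :: "'a::real_normed_vector \<Rightarrow> (('a \<Rightarrow>\<^sub>L real) \<Rightarrow>\<^sub>L real)" where
  "canon s = Blinfun (\<lambda>x'. blinfun_apply x' s)"

definition range_mf :: "('a \<times> 'b) set \<Rightarrow> 'b set" where
  "range_mf G = snd ` G"

definition monotone_mf :: "('a::real_normed_vector \<times> ('a \<Rightarrow>\<^sub>L real)) set \<Rightarrow> bool" where
  "monotone_mf G \<longleftrightarrow> (\<forall>(s, s')\<in>G. \<forall>(t, t')\<in>G. blinfun_apply (s' - t') (s - t) \<ge> 0)"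

definition maximally_monotone :: "('a::real_normed_vector \<times> ('a \<Rightarrow>\<^sub>L real)) set \<Rightarrow> bool" where
  "maximally_monotone G \<longleftrightarrow> monotone_mf G \<and>
     (\<forall>H. monotone_mf H \<and> G \<subseteq> H \<longrightarrow> H = G)"

definition quasidense :: "('a::real_normed_vector \<times> ('a \<Rightarrow>\<^sub>L real)) set \<Rightarrow> bool" where
  "quasidense G \<longleftrightarrow> (\<forall>x x'.
     (INF p\<in>G. ereal ((norm (fst p - x))\<^sup>2 / 2 + (norm (snd p - x'))\<^sup>2 / 2
                       + blinfun_apply (snd p - x') (fst p - x))) \<le> 0)"

definition type_FP :: "('a::real_normed_vector \<times> ('a \<Rightarrow>\<^sub>L real)) set \<Rightarrow> bool" where
  "type_FP G \<longleftrightarrow> monotone_mf G \<and> (\<forall>U w w'.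
     open U \<and> convex U \<and> U \<inter> range_mf G \<noteq> {} \<and> w' \<in> U \<and>
     (\<forall>(s, s')\<in>G. s' \<in> U \<longrightarrow> blinfun_apply (s' - w') (s - w) \<ge> 0)
     \<longrightarrow> (w, w') \<in> G)"

end

theory Submission
  imports Defs
begin

text \<open>
  Write q(x, x') = x'(x) and let (c) be the negative infimum condition NI.

  Quasidensity implies NI: given (w', w''), apply quasidensity at (0, w' - y') where y' nearly
  minimizes norm(y')^2/2 + w''(y').  FP implies NI: if NI fails at (w', w'') by a margin, some w
  agreeing with w'' on one functional s0' - w' with s0' in the range is monotonically related to the
  part of the graph over a thin neighbourhood of the segment from w' to s0', so (w, w') lies in
  the graph, which is absurd.

  For the converses, Fenchel duality (a sandwich form of Hahn-Banach) turns NI into the statement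
  that near every c there are points b at which the Fitzpatrick function exceeds q only slightly and
  q(b - c) + norm(b - c)^2/2 is small.  Iterating this at the points found gives a Cauchy
  sequence, so such b are close to the graph, which is quasidensity.  For FP the same
  duality is applied to the Fitzpatrick function inf-convolved with the support function of
  a neighbourhood K of the segment from w' to s0' and restricted to K; the resulting graph points
  lie over the given open set and converge to (w, w').
\<close>

section \<open>Hahn-Banach and the sandwich theorem\<close>

text \<open>Homogeneity is asked only as an inequality for positive \<open>t\<close>, the form that
  infima satisfy directly; applying it to \<open>inverse t\<close> gives equality.\<close>

definition sublinear :: "('a::real_vector \<Rightarrow> real) \<Rightarrow> bool" where
  "sublinear p \<longleftrightarrow> (\<forall>x y. p (x + y) \<le> p x + p y) \<and> (\<forall>t>0. \<forall>x. p (t *\<^sub>R x) \<le> t * p x)"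

lemma sublinear_add: "sublinear p \<Longrightarrow> p (x + y) \<le> p x + p y"
  unfolding sublinear_def by blast

lemma sublinear_scaleR:
  assumes "sublinear p" "t > 0"
  shows "p (t *\<^sub>R x) = t * p x"
proof (rule antisym)
  show "p (t *\<^sub>R x) \<le> t * p x" using assms unfolding sublinear_def by blast
  have "p (inverse t *\<^sub>R (t *\<^sub>R x)) \<le> inverse t * p (t *\<^sub>R x)"
    using assms unfolding sublinear_def by (meson positive_imp_inverse_positive)
  then show "t * p x \<le> p (t *\<^sub>R x)" using assms(2) by (simp add: field_simps)
qed

lemma sublinear_zero: "sublinear p \<Longrightarrow> p 0 = 0"
  using sublinear_scaleR[of p 2 0] by simp

text \<open>\<open>V x\<close> is a set of upper estimates at \<open>x\<close>. Any \<open>w\<close>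
  in \<open>V (- x)\<close> bounds it below, because \<open>v + w\<close> lies in \<open>V 0\<close>
  and is therefore nonnegative.\<close>

lemma bdd_below_conical:
  fixes V :: "'a::real_vector \<Rightarrow> real set"
  assumes nonempty: "\<And>x. V x \<noteq> {}"
    and add: "\<And>x y v w. v \<in> V x \<Longrightarrow> w \<in> V y \<Longrightarrow> v + w \<in> V (x + y)"
    and zero: "\<And>v. v \<in> V 0 \<Longrightarrow> 0 \<le> v"
  shows "bdd_below (V x)"
proof -
  obtain w where w: "w \<in> V (- x)" using nonempty by blast
  have "- w \<le> v" if "v \<in> V x" for v
    using zero[of "v + w"] add[OF that w] by simp
  then show ?thesis by (auto simp: bdd_below_def)
qed

text \<open>One source for all the sublinear functionals below: the minimality argument, the lower
  bound of a chain and the sandwich theorem each supply their own \<open>V\<close>.\<close>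

lemma sublinear_Inf_conical:
  fixes V :: "'a::real_vector \<Rightarrow> real set"
  assumes nonempty: "\<And>x. V x \<noteq> {}"
    and add: "\<And>x y v w. v \<in> V x \<Longrightarrow> w \<in> V y \<Longrightarrow> v + w \<in> V (x + y)"
    and scale: "\<And>x v t. v \<in> V x \<Longrightarrow> t > 0 \<Longrightarrow> t * v \<in> V (t *\<^sub>R x)"
    and zero: "\<And>v. v \<in> V 0 \<Longrightarrow> 0 \<le> v"
  shows "sublinear (\<lambda>x. Inf (V x))"
  unfolding sublinear_def
proof (intro conjI allI impI)
  note bdd = bdd_below_conical[of V, OF nonempty add zero]
  fix x y
  have "Inf (V (x + y)) - v \<le> Inf (V y)" if v: "v \<in> V x" for v
  proof (rule cInf_greatest[OF nonempty])
    fix w assume "w \<in> V y"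
    then have "Inf (V (x + y)) \<le> v + w" by (intro cInf_lower add v bdd)
    then show "Inf (V (x + y)) - v \<le> w" by simp
  qed
  then have "Inf (V (x + y)) - Inf (V y) \<le> v" if "v \<in> V x" for v
    using that by (fastforce simp: algebra_simps)
  then have "Inf (V (x + y)) - Inf (V y) \<le> Inf (V x)"
    by (rule cInf_greatest[OF nonempty])
  then show "Inf (V (x + y)) \<le> Inf (V x) + Inf (V y)" by simp
next
  note bdd = bdd_below_conical[of V, OF nonempty add zero]
  fix t :: real and x assume t: "t > 0"
  have "Inf (V (t *\<^sub>R x)) / t \<le> Inf (V x)"
  proof (rule cInf_greatest[OF nonempty])
    fix v assume "v \<in> V x"
    then have "Inf (V (t *\<^sub>R x)) \<le> t * v" by (intro cInf_lower scale t bdd)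
    then show "Inf (V (t *\<^sub>R x)) / t \<le> v" using t by (simp add: field_simps)
  qed
  then show "Inf (V (t *\<^sub>R x)) \<le> t * Inf (V x)" using t by (simp add: field_simps)
qed

text \<open>Tilting \<open>m\<close> along the ray spanned by \<open>y\<close> gives a sublinear
  functional below \<open>m\<close>, hence \<open>m\<close> itself. The parameter
  \<open>t = 1\<close> then yields the missing half of additivity.\<close>

lemma minimal_sublinear_add:
  assumes m: "sublinear m" and min: "\<And>n. sublinear n \<Longrightarrow> n \<le> m \<Longrightarrow> n = m"
  shows "m (x + y) = m x + m y"
proof -
  \<comment> \<open>Taking all upper bounds of the values, not just the values, lets subadditivity
    of \<open>m\<close> give closure under sums. Admitting \<open>t = 0\<close> places the infimum
    below \<open>m\<close>.\<close>
  define V where "V z = {a. \<exists>t\<ge>0. m (z + t *\<^sub>R y) - t * m y \<le> a}" for z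
  have mt: "m (t *\<^sub>R y) = t * m y" if "t \<ge> 0" for t
    using that sublinear_scaleR[OF m, of t] sublinear_zero[OF m] by (cases "t = 0") auto
  have ne: "V z \<noteq> {}" for z by (auto simp: V_def)
  have add: "v + w \<in> V (z + z')" if vw: "v \<in> V z" "w \<in> V z'" for z z' v w
  proof -
    obtain t t' where t: "t \<ge> 0" "t' \<ge> 0" "m (z + t *\<^sub>R y) - t * m y \<le> v"
      "m (z' + t' *\<^sub>R y) - t' * m y \<le> w" using vw by (auto simp: V_def)
    have "m (z + z' + (t + t') *\<^sub>R y) \<le> m (z + t *\<^sub>R y) + m (z' + t' *\<^sub>R y)"
      using sublinear_add[OF m, of "z + t *\<^sub>R y" "z' + t' *\<^sub>R y"] by (simp add: algebra_simps)
    then show ?thesis unfolding V_def using t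
      by (intro CollectI exI[of _ "t + t'"]) (auto simp: algebra_simps)
  qed
  have scale: "c * v \<in> V (c *\<^sub>R z)" if v: "v \<in> V z" and c: "c > 0" for z v c
  proof -
    obtain t where t: "t \<ge> 0" "m (z + t *\<^sub>R y) - t * m y \<le> v" using v by (auto simp: V_def)
    have "m (c *\<^sub>R z + (c * t) *\<^sub>R y) = c * m (z + t *\<^sub>R y)"
      using sublinear_scaleR[OF m c, of "z + t *\<^sub>R y"] by (simp add: algebra_simps)
    moreover have "c * (m (z + t *\<^sub>R y) - t * m y) \<le> c * v" using t c by simp
    ultimately show ?thesis unfolding V_def using t c
      by (intro CollectI exI[of _ "c * t"]) (auto simp: algebra_simps)
  qed
  have zero: "0 \<le> v" if "v \<in> V 0" for v using that mt by (auto simp: V_def)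
  note bdd = bdd_below_conical[of V, OF ne add zero]
  have in_V: "m (z + t *\<^sub>R y) - t * m y \<in> V z" if "t \<ge> 0" for z t
    using that by (auto simp: V_def)
  have "(\<lambda>z. Inf (V z)) \<le> m"
    unfolding le_fun_def using in_V[of 0] by (auto intro: cInf_lower bdd)
  with sublinear_Inf_conical[of V, OF ne add scale zero] have "(\<lambda>z. Inf (V z)) = m"
    by (intro min)
  then have "m x = Inf (V x)" by metis
  also have "\<dots> \<le> m (x + y) - m y"
    using in_V[of 1 x] by (intro cInf_lower bdd) simp
  finally show ?thesis using sublinear_add[OF m, of x y] by simp
qed

lemma minimal_sublinear_linear:
  assumes m: "sublinear m" and min: "\<And>n. sublinear n \<Longrightarrow> n \<le> m \<Longrightarrow> n = m"
  shows "linear m"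
proof (rule linearI)
  show add: "m (x + y) = m x + m y" for x y
    using minimal_sublinear_add[OF m] min by blast
  have neg: "m (- x) = - m x" for x
    using add[of x "- x"] sublinear_zero[OF m] by simp
  show "m (t *\<^sub>R x) = t *\<^sub>R m x" for t x
    using sublinear_scaleR[OF m, of t x] sublinear_scaleR[OF m, of "- t" x]
      sublinear_zero[OF m] neg[of "t *\<^sub>R x"]
    by (cases t "0::real" rule: linorder_cases) auto
qed

text \<open>Zorn's lemma gives a minimal sublinear functional below \<open>p\<close>, and minimal
  ones are linear.\<close>

theorem hahn_banach_sublinear:
  fixes p :: "'a::real_vector \<Rightarrow> real"
  assumes p: "sublinear p"
  obtains l where "linear l" "\<And>x. l x \<le> p x"
proof -
  define A where "A = {n. sublinear n \<and> n \<le> p}"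
  \<comment> \<open>The order is reversed, so that a maximal element for \<open>P\<close> is a
    minimal functional.\<close>
  define P where "P = (\<lambda>a b :: 'a \<Rightarrow> real. b \<le> a)"
  have "\<exists>m\<in>A. \<forall>a\<in>A. P m a \<longrightarrow> a = m"
  proof (rule predicate_Zorn)
    show "partial_order_on A (relation_of P A)"
      by (rule partial_order_on_relation_ofI) (auto simp: P_def)
  next
    fix C assume C: "C \<in> Chains (relation_of P A)"
    have CA: "n \<in> A" if "n \<in> C" for n
      using C that by (auto simp: Chains_def relation_of_def)
    have C_total: "n \<le> n' \<or> n' \<le> n" if "n \<in> C" "n' \<in> C" for n n'
      using C that by (auto simp: Chains_def relation_of_def P_def)
    show "\<exists>u\<in>A. \<forall>a\<in>C. P a u"
    proof (cases "C = {}")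
      case True then show ?thesis using p by (auto simp: A_def)
    next
      case False
      \<comment> \<open>The pointwise infimum of the chain. Sums stay in the family because the
        smaller of two members of the chain serves both arguments.\<close>
      define V where "V x = {a. \<exists>n\<in>C. n x \<le> a}" for x
      have sub: "sublinear n" "n \<le> p" if "n \<in> C" for n using CA[OF that] by (auto simp: A_def)
      have ne: "V x \<noteq> {}" for x using False by (auto simp: V_def)
      have add: "v + w \<in> V (x + y)" if vw: "v \<in> V x" "w \<in> V y" for x y v w
      proof -
        obtain n n' where n: "n \<in> C" "n' \<in> C" "n x \<le> v" "n' y \<le> w"
          using vw by (auto simp: V_def)
        then obtain k where k: "k \<in> C" "k \<le> n" "k \<le> n'" using C_total by blast
        have "k x \<le> n x" "k y \<le> n' y" using k by (auto simp: le_fun_def)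
        with sublinear_add[OF sub(1)[OF k(1)], of x y] n show ?thesis
          unfolding V_def using k by (intro CollectI bexI[of _ k]) auto
      qed
      have scale: "c * v \<in> V (c *\<^sub>R x)" if v: "v \<in> V x" and c: "c > 0" for x v c
      proof -
        obtain n where "n \<in> C" "n x \<le> v" using v by (auto simp: V_def)
        then show ?thesis unfolding V_def using sublinear_scaleR[OF sub(1), of n c x] c
          by (intro CollectI bexI[of _ n]) auto
      qed
      have zero: "0 \<le> v" if "v \<in> V 0" for v
        using that sublinear_zero[OF sub(1)] by (fastforce simp: V_def)
      have lower: "Inf (V x) \<le> n x" if "n \<in> C" for n x
        using that by (intro cInf_lower bdd_below_conical[of V, OF ne add zero]) (auto simp: V_def)
      have "Inf (V x) \<le> p x" for x
        using False lower sub(2) by (metis ex_in_conv le_fun_def order_trans)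
      then have "(\<lambda>x. Inf (V x)) \<in> A"
        using sublinear_Inf_conical[of V, OF ne add scale zero] by (auto simp: A_def le_fun_def)
      then show ?thesis using lower by (intro bexI[of _ "\<lambda>x. Inf (V x)"]) (auto simp: P_def le_fun_def)
    qed
  qed
  then obtain m where m: "sublinear m" "m \<le> p"
    and min: "\<And>n. sublinear n \<Longrightarrow> n \<le> p \<Longrightarrow> n \<le> m \<Longrightarrow> n = m"
    by (auto simp: A_def P_def)
  have "linear m" using m(1) by (rule minimal_sublinear_linear) (meson min m(2) order_trans)
  then show thesis using m(2) by (intro that[of m]) (auto simp: le_fun_def)
qed

text \<open>The sets A and B play the roles of the epigraph of a convex function and the
  hypograph of a concave function that is bounded below near a point of the domain of the former.\<close>
theorem convex_sandwich:
  fixes A B :: "('a::real_normed_vector \<times> real) set"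
  assumes A: "convex A" and B: "convex B"
    and le: "\<And>x a b. (x, a) \<in> A \<Longrightarrow> (x, b) \<in> B \<Longrightarrow> b \<le> a"
    and x0: "(x0, a0) \<in> A" and r: "r > 0" and cball: "\<And>x. norm (x - x0) \<le> r \<Longrightarrow> (x, m) \<in> B"
  obtains l :: "'a \<Rightarrow>\<^sub>L real" and k where
    "\<And>x a. (x, a) \<in> A \<Longrightarrow> l x + k \<le> a" "\<And>x b. (x, b) \<in> B \<Longrightarrow> b \<le> l x + k"
proof -
  \<comment> \<open>The cone generated by the differences of points of \<open>A\<close> and
    \<open>B\<close>. A linear functional below its infimum satisfies
    \<open>l c - l d \<le> a - b\<close>, which is the separation wanted.\<close>
  define V where "V x = {s * (a - b) |s c a d b. s > 0 \<and> (c, a) \<in> A \<and> (d, b) \<in> B \<and> x = s *\<^sub>R (c - d)}" for x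
  have V_I: "s * (a - b) \<in> V x" if "s > 0" "(c, a) \<in> A" "(d, b) \<in> B" "x = s *\<^sub>R (c - d)" for s a b c d x
    using that unfolding V_def by blast
  \<comment> \<open>Stepping from \<open>x0\<close> by length \<open>r\<close> against the direction
    of \<open>x\<close> stays in the ball where \<open>B\<close> has height \<open>m\<close>. This
    one estimate gives nonemptiness here and continuity of the functional later.\<close>
  have bound: "(norm x / r) * (a0 - m) \<in> V x" if "x \<noteq> 0" for x
    using that r by (intro V_I[of _ x0 _ "x0 - (r / norm x) *\<^sub>R x"] x0 cball) auto
  have ne: "V x \<noteq> {}" for x
  proof (cases "x = 0")
    case True
    have "1 * (a0 - m) \<in> V 0" using x0 r by (intro V_I[of _ x0 _ x0] cball) auto
    then show ?thesis using True by auto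
  qed (use bound in auto)
  have add: "v + w \<in> V (x + y)" if vw: "v \<in> V x" "w \<in> V y" for x y v w
  proof -
    obtain s a b c d where 1: "s > 0" "(c, a) \<in> A" "(d, b) \<in> B" "x = s *\<^sub>R (c - d)" "v = s * (a - b)"
      using vw(1) unfolding V_def by blast
    obtain s' a' b' c' d' where 2: "s' > 0" "(c', a') \<in> A" "(d', b') \<in> B" "y = s' *\<^sub>R (c' - d')" "w = s' * (a' - b')"
      using vw(2) unfolding V_def by blast
    \<comment> \<open>Normalizing the weights \<open>s\<close> and \<open>s'\<close> turns the sum
      of two cone elements into a multiple of a difference of convex combinations.\<close>
    define \<theta> where "\<theta> = s / (s + s')"
    have \<theta>: "\<theta> \<ge> 0" "1 - \<theta> \<ge> 0" "(s + s') * \<theta> = s" "(s + s') * (1 - \<theta>) = s'"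
      using 1(1) 2(1) by (auto simp: \<theta>_def field_simps)
    have "(\<theta> *\<^sub>R c + (1 - \<theta>) *\<^sub>R c', \<theta> * a + (1 - \<theta>) * a') \<in> A"
      using convexD[OF A 1(2) 2(2), of \<theta> "1 - \<theta>"] \<theta> by simp
    moreover have "(\<theta> *\<^sub>R d + (1 - \<theta>) *\<^sub>R d', \<theta> * b + (1 - \<theta>) * b') \<in> B"
      using convexD[OF B 1(3) 2(3), of \<theta> "1 - \<theta>"] \<theta> by simp
    moreover have "x + y = (s + s') *\<^sub>R ((\<theta> *\<^sub>R c + (1 - \<theta>) *\<^sub>R c') - (\<theta> *\<^sub>R d + (1 - \<theta>) *\<^sub>R d'))"
      unfolding 1(4) 2(4) scaleR_right_diff_distrib scaleR_right_distrib scaleR_scaleR \<theta>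
      by (simp add: algebra_simps)
    ultimately have "(s + s') * ((\<theta> * a + (1 - \<theta>) * a') - (\<theta> * b + (1 - \<theta>) * b')) \<in> V (x + y)"
      using 1(1) 2(1) by (intro V_I) auto
    moreover have "(s + s') * ((\<theta> * a + (1 - \<theta>) * a') - (\<theta> * b + (1 - \<theta>) * b'))
        = ((s + s') * \<theta>) * (a - b) + ((s + s') * (1 - \<theta>)) * (a' - b')"
      by (simp add: algebra_simps)
    ultimately show ?thesis unfolding \<theta> 1(5) 2(5) by simp
  qed
  have scale: "t * v \<in> V (t *\<^sub>R x)" if v: "v \<in> V x" and t: "t > 0" for x v t
  proof -
    obtain s a b c d where 1: "s > 0" "(c, a) \<in> A" "(d, b) \<in> B" "x = s *\<^sub>R (c - d)" "v = s * (a - b)"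
      using v unfolding V_def by blast
    have "(t * s) * (a - b) \<in> V (t *\<^sub>R x)"
      using 1 t by (intro V_I[of _ c _ d]) auto
    then show ?thesis by (simp add: 1(5) mult.assoc)
  qed
  have zero: "0 \<le> v" if "v \<in> V 0" for v
    using that le by (auto simp: V_def)
  obtain f where f: "linear f" "\<And>x. f x \<le> Inf (V x)"
    using hahn_banach_sublinear[OF sublinear_Inf_conical[of V, OF ne add scale zero]] by metis
  have f_le: "f x \<le> v" if "v \<in> V x" for x v
    using f(2)[of x] cInf_lower[OF that bdd_below_conical[of V, OF ne add zero]] by simp
  have f_norm: "f x \<le> norm x * ((a0 - m) / r)" for x
    using f_le[OF bound, of x] linear_0[OF f(1)] by (cases "x = 0") auto
  have "bounded_linear f"
  proof (rule bounded_linear_intro)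
    show "f (x + y) = f x + f y" for x y using f(1) by (rule linear_add)
    show "f (t *\<^sub>R x) = t *\<^sub>R f x" for t x using f(1) by (rule linear_scale)
    show "norm (f x) \<le> norm x * ((a0 - m) / r)" for x
      using f_norm[of x] f_norm[of "- x"] linear_neg[OF f(1), of x] by simp
  qed
  then obtain l where l: "f = blinfun_apply l" by (metis bounded_linear_Blinfun_apply)
  have sep: "b - l d \<le> a - l c" if "(c, a) \<in> A" "(d, b) \<in> B" for a b c d
    using f_le[OF V_I[of 1, OF _ that]] by (simp add: l blinfun.diff_right)
  \<comment> \<open>The least constant that puts the affine function above \<open>B\<close>; the
    point over \<open>x0\<close> keeps it finite.\<close>
  define K where "K = Sup {b - l d |d b. (d, b) \<in> B}"
  have bdd: "bdd_above {b - l d |d b. (d, b) \<in> B}" using sep[OF x0] by (auto simp: bdd_above_def)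
  have ne_B: "{b - l d |d b. (d, b) \<in> B} \<noteq> {}" using cball[of x0] r by auto
  show thesis
  proof (rule that)
    show "l x + K \<le> a" if "(x, a) \<in> A" for x a
      using cSup_least[OF ne_B, of "a - l x"] sep[OF that] unfolding K_def by fastforce
    show "b \<le> l x + K" if "(x, b) \<in> B" for x b
      using cSup_upper[OF _ bdd, of "b - l x"] that unfolding K_def by fastforce
  qed
qed

section \<open>Duality on the product of a space and its dual\<close>

text \<open>The infimum of the left side is exactly the negative of half the squared dual norm, but
  it need not be attained. A vector of norm slightly below \<open>norm f\<close>, chosen where
  \<open>f\<close> is almost norming, comes close enough.\<close>

lemma near_minimizer_norm_square:
  fixes f :: "'a::real_normed_vector \<Rightarrow>\<^sub>L real"
  assumes \<eta>: "\<eta> > 0"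
  obtains u where "(norm u)\<^sup>2 / 2 + f u \<le> - (norm f)\<^sup>2 / 2 + \<eta>"
proof (cases "(norm f)\<^sup>2 \<le> 2 * \<eta>")
  case True
  then show ?thesis by (intro that[of 0]) simp
next
  case False
  define F where "F = norm f"
  \<comment> \<open>Below \<open>F\<close>, so that some \<open>x\<close> has
    \<open>\<bar>f x\<bar>\<close> above \<open>c * norm x\<close>, yet its square loses at most
    \<open>2 * \<eta>\<close>.\<close>
  define c where "c = F - \<eta> / F"
  have F: "F > 0" "F\<^sup>2 > 2 * \<eta>" using False \<eta> by (auto simp: F_def intro: ccontr)
  then have c: "c > 0" "c < F" using \<eta> by (auto simp: c_def field_simps power2_eq_square)
  have "c\<^sup>2 = F\<^sup>2 - 2 * \<eta> + (\<eta> / F)\<^sup>2"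
    using F by (simp add: c_def power2_eq_square field_simps)
  then have c2: "F\<^sup>2 - 2 * \<eta> \<le> c\<^sup>2" by simp
  obtain x where x: "c * norm x < \<bar>f x\<bar>"
    using norm_blinfun_bound[of c f] c by (metis F_def less_imp_le not_le real_norm_def)
  then have nx: "norm x > 0" by (cases "x = 0") auto
  define u where "u = (- c * sgn (f x) / norm x) *\<^sub>R x"
  have fx: "f x \<noteq> 0" using x c nx by (smt (verit) mult_nonneg_nonneg)
  have "norm u = c" using nx c fx by (simp add: u_def abs_mult abs_sgn_eq)
  moreover have "f u = - c * (\<bar>f x\<bar> / norm x)"
    by (simp add: u_def blinfun.scaleR_right blinfun.minus_right abs_sgn)
  moreover have "c * c \<le> c * (\<bar>f x\<bar> / norm x)"
    using x nx c by (intro mult_left_mono) (auto simp: field_simps)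
  ultimately show ?thesis using c2 by (intro that[of u]) (simp add: F_def power2_eq_square)
qed

section \<open>The quadratic form of the duality and its polar form\<close>

definition coupling :: "'a::real_normed_vector \<times> ('a \<Rightarrow>\<^sub>L real) \<Rightarrow> real" where
  "coupling b = snd b (fst b)"

text \<open>The symmetric bilinear form polar to \<open>coupling\<close>: \<open>pairing b b\<close>
  is twice \<open>coupling b\<close>.\<close>

definition pairing ::
  "'a::real_normed_vector \<times> ('a \<Rightarrow>\<^sub>L real) \<Rightarrow> 'a \<times> ('a \<Rightarrow>\<^sub>L real) \<Rightarrow> real" where
  "pairing b d = snd b (fst d) + snd d (fst b)"

lemmas coupling_simps = coupling_def pairing_def blinfun.add_left blinfun.add_right
  blinfun.diff_left blinfun.diff_right blinfun.scaleR_left blinfun.scaleR_right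

lemma coupling_add: "coupling (b + d) = coupling b + pairing b d + coupling d"
  by (simp add: coupling_simps)

lemma coupling_diff: "coupling (b - d) = coupling b - pairing b d + coupling d"
  by (simp add: coupling_simps)

lemma coupling_minus_commute: "coupling (s - t) = coupling (t - s)"
  by (simp add: coupling_simps)

lemma coupling_zero [simp]: "coupling 0 = 0"
  by (simp add: coupling_def)

text \<open>Cauchy-Schwarz in the plane for the component norms, since the norm of a product is
  Euclidean.\<close>

lemma abs_pairing_le: "\<bar>pairing b d\<bar> \<le> norm b * norm d"
proof -
  have "\<bar>pairing b d\<bar> \<le> norm (snd b) * norm (fst d) + norm (snd d) * norm (fst b)"
    unfolding pairing_def
    using norm_blinfun[of "snd b" "fst d"] norm_blinfun[of "snd d" "fst b"] by simp
  also have "\<dots> \<le> norm b * norm d"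
  proof (rule power2_le_imp_le)
    have "0 \<le> (norm (snd b) * norm (snd d) - norm (fst b) * norm (fst d))\<^sup>2" by simp
    then show "(norm (snd b) * norm (fst d) + norm (snd d) * norm (fst b))\<^sup>2 \<le> (norm b * norm d)\<^sup>2"
      unfolding power_mult_distrib norm_prod_def real_sqrt_pow2[OF sum_power2_ge_zero]
      by (simp add: algebra_simps power2_eq_square)
  qed simp
  finally show ?thesis .
qed

text \<open>Hence the expression in quasidensity is never negative, which bounds the slack of an
  approximate solution in the later estimates.\<close>

lemma abs_coupling_le: "\<bar>coupling b\<bar> \<le> (norm b)\<^sup>2 / 2"
  using abs_pairing_le[of b b] by (simp add: coupling_def pairing_def power2_eq_square)

lemma continuous_on_coupling [continuous_intros]:
  "continuous_on S f \<Longrightarrow> continuous_on S (\<lambda>x. coupling (f x))"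
  unfolding coupling_def by (intro continuous_intros)

lemma convex_hypograph_neg_norm_square:
  "convex {(x::'a::real_normed_vector, b). b \<le> \<epsilon> - (norm x)\<^sup>2 / 2}"
proof (rule convexI, clarsimp)
  fix x y :: 'a and b b' u v :: real
  assume uv: "0 \<le> u" "0 \<le> v" "u + v = 1"
    and b: "b \<le> \<epsilon> - (norm x)\<^sup>2 / 2" "b' \<le> \<epsilon> - (norm y)\<^sup>2 / 2"
  have "(norm (u *\<^sub>R x + v *\<^sub>R y))\<^sup>2 \<le> (u * norm x + v * norm y)\<^sup>2"
    using uv norm_triangle_ineq[of "u *\<^sub>R x" "v *\<^sub>R y"] by (intro power_mono) auto
  also have "\<dots> = u * (norm x)\<^sup>2 + v * (norm y)\<^sup>2 - u * v * (norm x - norm y)\<^sup>2"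
    using uv(3) by algebra
  also have "\<dots> \<le> u * (norm x)\<^sup>2 + v * (norm y)\<^sup>2" using uv by simp
  finally have "(norm (u *\<^sub>R x + v *\<^sub>R y))\<^sup>2 \<le> u * (norm x)\<^sup>2 + v * (norm y)\<^sup>2" .
  moreover have "u * b + v * b' \<le> u * (\<epsilon> - (norm x)\<^sup>2 / 2) + v * (\<epsilon> - (norm y)\<^sup>2 / 2)"
    using b uv by (intro add_mono mult_left_mono)
  moreover have "u * \<epsilon> + v * \<epsilon> = \<epsilon>" using uv(3) by (metis distrib_right mult_1)
  ultimately show "u * b + v * b' \<le> \<epsilon> - (norm (u *\<^sub>R x + v *\<^sub>R y))\<^sup>2 / 2"
    by (simp add: algebra_simps)
qed

lemma blinfun_prod_split:
  fixes l :: "('a::real_normed_vector \<times> 'b::real_normed_vector) \<Rightarrow>\<^sub>L real"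
  obtains l1 :: "'a \<Rightarrow>\<^sub>L real" and l2 :: "'b \<Rightarrow>\<^sub>L real" where "\<And>x y. l (x, y) = l1 x + l2 y"
proof -
  have 1: "bounded_linear (\<lambda>x. l (x, 0))" and 2: "bounded_linear (\<lambda>y. l (0, y))"
    by (intro bounded_linear_compose[OF blinfun.bounded_linear_right]
        bounded_linear_Pair bounded_linear_ident bounded_linear_zero)+
  have "l (x, y) = Blinfun (\<lambda>x. l (x, 0)) x + Blinfun (\<lambda>y. l (0, y)) y" for x y
    using blinfun.add_right[of l "(x, 0)" "(0, y)"]
    by (simp add: bounded_linear_Blinfun_apply[OF 1] bounded_linear_Blinfun_apply[OF 2])
  then show thesis by (rule that)
qed

text \<open>A convex function on the product of a space and its dual is encoded by a convex set A
  above its graph; the hypothesis says that the conjugate of the function dominates the pairing of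
  the dual and the bidual.\<close>
lemma infimum_plus_norm_square_le:
  fixes A :: "(('a::real_normed_vector \<times> ('a \<Rightarrow>\<^sub>L real)) \<times> real) set"
  assumes A: "convex A" "A \<noteq> {}" and \<epsilon>: "\<epsilon> > 0"
    and dual: "\<And>(v' :: 'a \<Rightarrow>\<^sub>L real) (v'' :: ('a \<Rightarrow>\<^sub>L real) \<Rightarrow>\<^sub>L real) \<delta>. \<delta> > 0 \<Longrightarrow> \<exists>y y' a. ((y, y'), a) \<in> A \<and> a < blinfun_apply v' y + blinfun_apply v'' y' - blinfun_apply v'' v' + \<delta>"
  obtains b a where "(b, a) \<in> A" "a + (norm b)\<^sup>2 / 2 < \<epsilon>"
proof -
  have "\<exists>(b, a)\<in>A. a + (norm b)\<^sup>2 / 2 < \<epsilon>"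
  proof (rule ccontr)
    assume "\<not> ?thesis"
    then have neg: "\<epsilon> \<le> a + (norm b)\<^sup>2 / 2" if "(b, a) \<in> A" for b a
      using that by force
    \<comment> \<open>The sandwich theorem will place an affine function between \<open>A\<close>
      and this concave hypograph.\<close>
    define B where "B = {(x::'a \<times> ('a \<Rightarrow>\<^sub>L real), b). b \<le> \<epsilon> - (norm x)\<^sup>2 / 2}"
    obtain x0 a0 where x0: "(x0, a0) \<in> A" using A(2) by auto
    have "convex B" unfolding B_def by (rule convex_hypograph_neg_norm_square)
    moreover have "b \<le> a" if "(x, a) \<in> A" "(x, b) \<in> B" for x a b
      using neg[OF that(1)] that(2) by (simp add: B_def)
    moreover have "(x, \<epsilon> - (norm x0 + 1)\<^sup>2 / 2) \<in> B" if "norm (x - x0) \<le> 1" for x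
    proof -
      have "norm x \<le> norm x0 + 1" using that norm_triangle_sub[of x x0] by simp
      then show ?thesis by (auto simp: B_def intro: power_mono)
    qed
    ultimately obtain l k where l: "\<And>x a. (x, a) \<in> A \<Longrightarrow> blinfun_apply l x + k \<le> a"
      "\<And>x b. (x, b) \<in> B \<Longrightarrow> b \<le> blinfun_apply l x + k"
      using convex_sandwich[OF A(1) _ _ x0 zero_less_one, of B] by blast
    obtain v' v'' where v: "\<And>y y'. l (y, y') = blinfun_apply v' y + blinfun_apply v'' y'"
      using blinfun_prod_split[of l] by blast
    \<comment> \<open>Maximizing the concave side against \<open>l\<close> conjugates half the
      squared norm into half the squared dual norms of the two components. Their sum is at least the
      product of those norms, hence at least \<open>- v'' v'\<close>.\<close>
    have k: "\<epsilon> + (norm v')\<^sup>2 / 2 + (norm v'')\<^sup>2 / 2 \<le> k"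
    proof (rule field_le_epsilon)
      fix \<eta> :: real assume \<eta>: "\<eta> > 0"
      obtain u where u: "(norm u)\<^sup>2 / 2 + v' u \<le> - (norm v')\<^sup>2 / 2 + \<eta> / 2"
        using near_minimizer_norm_square[of "\<eta> / 2" v'] \<eta> by auto
      obtain u' where u': "(norm u')\<^sup>2 / 2 + v'' u' \<le> - (norm v'')\<^sup>2 / 2 + \<eta> / 2"
        using near_minimizer_norm_square[of "\<eta> / 2" v''] \<eta> by auto
      have "\<epsilon> - (norm (u, u'))\<^sup>2 / 2 \<le> v' u + v'' u' + k"
        using l(2)[of "(u, u')"] by (simp add: B_def v)
      then have "\<epsilon> - (norm u)\<^sup>2 / 2 - (norm u')\<^sup>2 / 2 \<le> v' u + v'' u' + k"
        by (simp add: norm_Pair add_divide_distrib)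
      with u u' show "\<epsilon> + (norm v')\<^sup>2 / 2 + (norm v'')\<^sup>2 / 2 \<le> k + \<eta>" by simp
    qed
    have "\<bar>v'' v'\<bar> \<le> norm v'' * norm v'" using norm_blinfun[of v'' v'] by simp
    moreover have "0 \<le> (norm v' - norm v'')\<^sup>2" by simp
    ultimately have k': "\<epsilon> - v'' v' \<le> k" using k by (simp add: power2_eq_square algebra_simps)
    obtain y y' a where "((y, y'), a) \<in> A" "a < v' y + v'' y' - v'' v' + \<epsilon>"
      using dual[OF \<epsilon>] by blast
    with l(1)[of "(y, y')" a] k' show False by (simp add: v)
  qed
  then show thesis using that by auto
qed

section \<open>Enlargements of a maximally monotone graph\<close>

text \<open>The points where the Fitzpatrick function of \<open>G\<close> exceeds
  \<open>coupling\<close> by at most \<epsilon>.\<close>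

definition enlargement ::
  "('a::real_normed_vector \<times> ('a \<Rightarrow>\<^sub>L real)) set \<Rightarrow> real \<Rightarrow> ('a \<times> ('a \<Rightarrow>\<^sub>L real)) set" where
  "enlargement G \<epsilon> = {b. \<forall>s\<in>G. - \<epsilon> \<le> coupling (s - b)}"

lemma enlargement_mono: "\<epsilon> \<le> \<epsilon>' \<Longrightarrow> enlargement G \<epsilon> \<subseteq> enlargement G \<epsilon>'"
  by (fastforce simp: enlargement_def)

lemma monotone_mf_iff: "monotone_mf G \<longleftrightarrow> (\<forall>s\<in>G. \<forall>t\<in>G. 0 \<le> coupling (s - t))"
  by (fastforce simp: monotone_mf_def coupling_def)

lemma maximally_monotone_coupling_nonneg:
  "maximally_monotone G \<Longrightarrow> s \<in> G \<Longrightarrow> t \<in> G \<Longrightarrow> 0 \<le> coupling (s - t)"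
  by (simp add: maximally_monotone_def monotone_mf_iff)

lemma maximally_monotone_memI:
  assumes G: "maximally_monotone G" and b: "\<And>s. s \<in> G \<Longrightarrow> 0 \<le> coupling (s - b)"
  shows "b \<in> G"
proof -
  have "monotone_mf (insert b G)"
    using b maximally_monotone_coupling_nonneg[OF G]
    by (auto simp: monotone_mf_iff coupling_minus_commute[of b])
  then have "insert b G = G" using G unfolding maximally_monotone_def by blast
  then show ?thesis by blast
qed

text \<open>In other words, the Fitzpatrick function of a maximally monotone graph dominates
  \<open>coupling\<close>.\<close>

lemma maximally_monotone_exists_coupling_le:
  assumes "maximally_monotone G" "\<delta> > 0"
  obtains s where "s \<in> G" "coupling (s - b) < \<delta>"
proof (cases "b \<in> G")
  case True then show ?thesis using assms(2) by (intro that[of b]) auto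
next
  case False
  then show ?thesis using maximally_monotone_memI[OF assms(1), of b] assms(2) that
    by (metis less_trans not_le)
qed

lemma enlargement_nonneg:
  assumes "maximally_monotone G" "b \<in> enlargement G \<epsilon>"
  shows "0 \<le> \<epsilon>"
proof (rule ccontr)
  assume "\<not> 0 \<le> \<epsilon>"
  then obtain s where "s \<in> G" "coupling (s - b) < - \<epsilon>"
    using maximally_monotone_exists_coupling_le[OF assms(1), of "- \<epsilon>" b] by auto
  then show False using assms(2) by (auto simp: enlargement_def)
qed

text \<open>Compare both points with their midpoint.\<close>
lemma enlargement_coupling_ge:
  assumes G: "maximally_monotone G" and b: "b \<in> enlargement G \<epsilon>" and b': "b' \<in> enlargement G \<epsilon>'"
  shows "- 2 * (\<epsilon> + \<epsilon>') \<le> coupling (b - b')"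
proof (rule field_le_epsilon)
  fix \<delta> :: real assume \<delta>: "\<delta> > 0"
  define m where "m = (1/2) *\<^sub>R (b + b')"
  obtain s where s: "s \<in> G" "coupling (s - m) < \<delta> / 4"
    using maximally_monotone_exists_coupling_le[OF G, of "\<delta> / 4" m] \<delta> by auto
  have "coupling (s - m) = coupling (s - b) / 2 + coupling (s - b') / 2 - coupling (b - b') / 4"
    by (simp add: m_def coupling_simps field_simps)
  moreover have "- \<epsilon> \<le> coupling (s - b)" "- \<epsilon>' \<le> coupling (s - b')"
    using b b' s by (auto simp: enlargement_def)
  ultimately show "- 2 * (\<epsilon> + \<epsilon>') \<le> coupling (b - b') + \<delta>" using s by (simp add: field_simps)
qed

text \<open>The epigraph of the Fitzpatrick function of the translate of G by -c.\<close>
definition fitzpatrick_epi ::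
  "('a::real_normed_vector \<times> ('a \<Rightarrow>\<^sub>L real)) set \<Rightarrow> 'a \<times> ('a \<Rightarrow>\<^sub>L real)
    \<Rightarrow> (('a \<times> ('a \<Rightarrow>\<^sub>L real)) \<times> real) set" where
  "fitzpatrick_epi G c = {(d, a). \<forall>s\<in>G. pairing (s - c) d - coupling (s - c) \<le> a}"

text \<open>Translating by \<open>c\<close> centres the norm term at the origin; the height above
  \<open>coupling d\<close> becomes the enlargement parameter.\<close>

lemma fitzpatrick_epi_iff_enlargement:
  "(d, a) \<in> fitzpatrick_epi G c \<longleftrightarrow> c + d \<in> enlargement G (a - coupling d)"
proof -
  have "coupling (s - (c + d)) = coupling (s - c) - pairing (s - c) d + coupling d" for s
    using coupling_diff[of "s - c" d] by (simp add: algebra_simps)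
  then have "pairing (s - c) d - coupling (s - c) \<le> a \<longleftrightarrow> - (a - coupling d) \<le> coupling (s - (c + d))" for s
    by auto
  then show ?thesis by (simp add: fitzpatrick_epi_def enlargement_def)
qed

lemma graph_in_fitzpatrick_epi:
  assumes "maximally_monotone G" "s \<in> G"
  shows "(s - c, coupling (s - c)) \<in> fitzpatrick_epi G c"
  using maximally_monotone_coupling_nonneg[OF assms(1)] assms(2)
  by (simp add: fitzpatrick_epi_iff_enlargement enlargement_def)

lemma convex_fitzpatrick_epi: "convex (fitzpatrick_epi G c)"
proof -
  have "fitzpatrick_epi G c = (\<Inter>s\<in>G. {(d, a). pairing (s - c) d - coupling (s - c) \<le> a})"
    by (auto simp: fitzpatrick_epi_def)
  moreover have "convex {(d, a). pairing b d - k \<le> a}" for b :: "'a \<times> ('a \<Rightarrow>\<^sub>L real)" and k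
  proof (rule convexI, clarsimp)
    fix d d' :: 'a and e e' :: "'a \<Rightarrow>\<^sub>L real" and a a' u v :: real
    assume uv: "0 \<le> u" "0 \<le> v" "u + v = 1"
      and le: "pairing b (d, e) - k \<le> a" "pairing b (d', e') - k \<le> a'"
    have "pairing b (u *\<^sub>R d + v *\<^sub>R d', u *\<^sub>R e + v *\<^sub>R e') = u * pairing b (d, e) + v * pairing b (d', e')"
      by (simp add: coupling_simps algebra_simps)
    then have "pairing b (u *\<^sub>R d + v *\<^sub>R d', u *\<^sub>R e + v *\<^sub>R e') - k
        = u * (pairing b (d, e) - k) + v * (pairing b (d', e') - k)"
      using uv(3) by algebra
    also have "\<dots> \<le> u * a + v * a'" using uv le by (intro add_mono mult_left_mono)
    finally show "pairing b (u *\<^sub>R d + v *\<^sub>R d', u *\<^sub>R e + v *\<^sub>R e') - k \<le> u * a + v * a'" .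
  qed
  ultimately show ?thesis by (simp add: convex_INT)
qed

section \<open>Negative infimum and quasidensity\<close>

text \<open>Gossez' condition of negative infimum: statement (c) without extended reals.\<close>
definition type_NI :: "('a::real_normed_vector \<times> ('a \<Rightarrow>\<^sub>L real)) set \<Rightarrow> bool" where
  "type_NI G \<longleftrightarrow> (\<forall>(w' :: 'a \<Rightarrow>\<^sub>L real) (w'' :: ('a \<Rightarrow>\<^sub>L real) \<Rightarrow>\<^sub>L real). \<forall>\<epsilon>>0.
     \<exists>p\<in>G. blinfun_apply (canon (fst p) - w'') (snd p - w') < \<epsilon>)"

section \<open>The conditions rewritten with real inequalities\<close>

lemma canon_apply [simp]: "blinfun_apply (canon s) x' = blinfun_apply x' s"
  unfolding canon_def by (simp add: bounded_linear_Blinfun_apply blinfun.bounded_linear_left)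

lemma INF_ereal_le_zero_iff:
  "(INF p\<in>G. ereal (f p)) \<le> 0 \<longleftrightarrow> (\<forall>\<epsilon>>0. \<exists>p\<in>G. f p < \<epsilon>)"
proof
  assume L: "(INF p\<in>G. ereal (f p)) \<le> 0"
  show "\<forall>\<epsilon>>0. \<exists>p\<in>G. f p < \<epsilon>"
  proof (intro allI impI)
    fix \<epsilon> :: real assume "\<epsilon> > 0"
    then have "(INF p\<in>G. ereal (f p)) < ereal \<epsilon>" using L by (simp add: order_le_less_trans)
    then show "\<exists>p\<in>G. f p < \<epsilon>" by (auto simp: INF_less_iff)
  qed
next
  assume R: "\<forall>\<epsilon>>0. \<exists>p\<in>G. f p < \<epsilon>"
  show "(INF p\<in>G. ereal (f p)) \<le> 0"
  proof (rule ereal_le_epsilon2)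
    fix \<epsilon> :: real assume "\<epsilon> > 0"
    then obtain p where "p \<in> G" "f p < \<epsilon>" using R by blast
    then show "(INF p\<in>G. ereal (f p)) \<le> 0 + ereal \<epsilon>"
      by (intro INF_lower2[of p]) auto
  qed
qed

text \<open>The Euclidean product norm merges the two half squares into one.\<close>

lemma quasidense_iff:
  "quasidense G \<longleftrightarrow> (\<forall>c. \<forall>\<epsilon>>0. \<exists>s\<in>G. coupling (s - c) + (norm (s - c))\<^sup>2 / 2 < \<epsilon>)"
  unfolding quasidense_def INF_ereal_le_zero_iff
  by (simp add: coupling_def norm_prod_def add_divide_distrib algebra_simps split_paired_All)

text \<open>Negative infimum at the translate of \<open>(v', v'')\<close> by \<open>c\<close>,
  expanded. The result is the \<open>dual\<close> hypothesis of
  \<open>infimum_plus_norm_square_le\<close>.\<close>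

lemma type_NI_coupling:
  assumes "type_NI G" "\<delta> > 0"
  obtains s where "s \<in> G"
    "coupling (s - c) < blinfun_apply v' (fst (s - c)) + blinfun_apply v'' (snd (s - c)) - blinfun_apply v'' v' + \<delta>"
proof -
  obtain s where s: "s \<in> G"
    "blinfun_apply (canon (fst s) - (canon (fst c) + v'')) (snd s - (snd c + v')) < \<delta>"
    using assms unfolding type_NI_def by blast
  then show ?thesis
    by (intro that[of s]) (auto simp: coupling_simps algebra_simps)
qed

lemma type_NI_enlargement_near:
  assumes G: "maximally_monotone G" and NI: "type_NI G" and \<epsilon>: "\<epsilon> > 0"
  obtains b e where "b \<in> enlargement G e" "e + coupling (b - c) + (norm (b - c))\<^sup>2 / 2 < \<epsilon>"
proof -
  have "\<exists>y y' a. ((y, y'), a) \<in> fitzpatrick_epi G c \<and>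
      a < blinfun_apply v' y + blinfun_apply v'' y' - blinfun_apply v'' v' + \<delta>"
    if "\<delta> > 0" for v' v'' \<delta>
    using type_NI_coupling[OF NI that, of c v' v''] graph_in_fitzpatrick_epi[OF G, of _ c]
    by (metis prod.collapse)
  moreover have "fitzpatrick_epi G c \<noteq> {}"
    using calculation[of 1] by auto
  ultimately obtain d a where "(d, a) \<in> fitzpatrick_epi G c" "a + (norm d)\<^sup>2 / 2 < \<epsilon>"
    using infimum_plus_norm_square_le[OF convex_fitzpatrick_epi[of G c] _ \<epsilon>] by metis
  then show ?thesis
    by (intro that[of "c + d" "a - coupling d"]) (auto simp: fitzpatrick_epi_iff_enlargement)
qed

text \<open>Centring the search at \<open>b\<close> itself works because \<open>coupling\<close>
  between two enlargement points cannot be very negative; the small sum then forces a small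
  norm.\<close>

lemma type_NI_enlargement_step:
  assumes G: "maximally_monotone G" and NI: "type_NI G" and \<tau>: "\<tau> > 0"
    and b: "b \<in> enlargement G (\<tau>\<^sup>2)"
  obtains b' where "b' \<in> enlargement G ((\<tau> / 2)\<^sup>2)" "norm (b' - b) \<le> 3 * \<tau>"
proof -
  obtain b' e where b': "b' \<in> enlargement G e" "e + coupling (b' - b) + (norm (b' - b))\<^sup>2 / 2 < (\<tau> / 2)\<^sup>2"
    using type_NI_enlargement_near[OF G NI, of "(\<tau> / 2)\<^sup>2" b] \<tau> by auto
  have "e \<ge> 0" using enlargement_nonneg[OF G b'(1)] .
  have "e \<le> (\<tau> / 2)\<^sup>2" using b'(2) abs_coupling_le[of "b' - b"] by simp
  then have e: "b' \<in> enlargement G ((\<tau> / 2)\<^sup>2)" using b'(1) enlargement_mono by blast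
  have "- 2 * ((\<tau> / 2)\<^sup>2 + \<tau>\<^sup>2) \<le> coupling (b' - b)"
    by (rule enlargement_coupling_ge[OF G e b])
  \<comment> \<open>The lower bound is \<open>- 5/2\<close> times the square of \<tau>; adding the
    tolerance of one quarter and doubling gives \<open>11 / 2\<close>.\<close>
  with b'(2) \<open>e \<ge> 0\<close> have "(norm (b' - b))\<^sup>2 \<le> 11 / 2 * \<tau>\<^sup>2" by (simp add: power_divide)
  also have "\<dots> \<le> (3 * \<tau>)\<^sup>2" by (simp add: power_mult_distrib)
  finally have "(norm (b' - b))\<^sup>2 \<le> (3 * \<tau>)\<^sup>2" .
  then have "norm (b' - b) \<le> 3 * \<tau>" using \<tau> power2_le_imp_le[of "norm (b' - b)" "3 * \<tau>"] by simp
  then show ?thesis using that e by blast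
qed

text \<open>A Bronsted-Rockafellar type property, by iterating the preceding step.\<close>
lemma type_NI_enlargement_close:
  fixes G :: "('a::banach \<times> ('a \<Rightarrow>\<^sub>L real)) set"
  assumes G: "maximally_monotone G" and NI: "type_NI G" and \<tau>: "\<tau> > 0"
    and b: "b \<in> enlargement G (\<tau>\<^sup>2)"
  obtains s where "s \<in> G" "norm (s - b) \<le> 6 * \<tau>"
proof -
  \<comment> \<open>The clause for \<open>n = 0\<close> pins the start at \<open>b\<close>, as the
    choice principle only returns some sequence satisfying \<open>P\<close>.\<close>
  define P where "P n x \<longleftrightarrow> x \<in> enlargement G ((\<tau> / 2 ^ n)\<^sup>2) \<and> (n = 0 \<longrightarrow> x = b)" for n x
  have "\<exists>f. \<forall>n. P n (f n) \<and> norm (f (Suc n) - f n) \<le> 3 * (\<tau> / 2 ^ n)"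
  proof (rule dependent_nat_choice)
    show "\<exists>x. P 0 x" using b by (intro exI[of _ b]) (simp add: P_def)
    show "\<exists>y. P (Suc n) y \<and> norm (y - x) \<le> 3 * (\<tau> / 2 ^ n)" if "P n x" for x n
    proof -
      have "\<tau> / 2 ^ n > 0" "x \<in> enlargement G ((\<tau> / 2 ^ n)\<^sup>2)" using \<tau> that by (auto simp: P_def)
      then obtain y where "y \<in> enlargement G ((\<tau> / 2 ^ n / 2)\<^sup>2)" "norm (y - x) \<le> 3 * (\<tau> / 2 ^ n)"
        using type_NI_enlargement_step[OF G NI] by blast
      then show ?thesis by (intro exI[of _ y]) (simp add: P_def mult.commute)
    qed
  qed
  then obtain f where P: "\<And>n. P n (f n)" and step: "\<And>n. norm (f (Suc n) - f n) \<le> 3 * (\<tau> / 2 ^ n)"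
    by blast
  have f0: "f 0 = b" using P[of 0] by (simp add: P_def)
  define g where "g n = f (Suc n) - f n" for n
  have geo: "(\<lambda>n. 3 * \<tau> * (1 / 2) ^ n) sums (6 * \<tau>)"
    using sums_mult[OF geometric_sums[of "1 / 2 :: real"], of "3 * \<tau>"] by simp
  have g_le: "norm (g n) \<le> 3 * \<tau> * (1 / 2) ^ n" for n
    using step[of n] by (simp add: g_def power_divide)
  have sn: "summable (\<lambda>n. norm (g n))"
    by (rule summable_comparison_test'[OF sums_summable[OF geo], of 0]) (use g_le in auto)
  have "norm (suminf g) \<le> (\<Sum>n. norm (g n))" by (rule summable_norm[OF sn])
  also have "\<dots> \<le> 6 * \<tau>"
    using suminf_le[OF g_le sn sums_summable[OF geo]] sums_unique[OF geo] by simp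
  finally have dist: "norm (suminf g) \<le> 6 * \<tau>" .
  have "(\<lambda>n. \<Sum>i<n. g i) \<longlonglongrightarrow> suminf g"
    using summable_norm_cancel[OF sn] by (rule summable_LIMSEQ)
  then have "(\<lambda>n. b + (f n - f 0)) \<longlonglongrightarrow> b + suminf g"
    unfolding g_def sum_lessThan_telescope by (intro tendsto_intros)
  then have lim: "f \<longlonglongrightarrow> b + suminf g" by (simp add: f0)
  \<comment> \<open>The enlargement parameters tend to zero, so the limit is monotonically related
    to all of \<open>G\<close>, and maximality applies.\<close>
  have "0 \<le> coupling (s - (b + suminf g))" if s: "s \<in> G" for s
  proof (rule LIMSEQ_le)
    show "(\<lambda>n. coupling (s - f n)) \<longlonglongrightarrow> coupling (s - (b + suminf g))"
      using continuous_on_tendsto_compose[of UNIV "\<lambda>x. coupling (s - x)", OF _ lim]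
      by (simp add: continuous_intros)
    show "(\<lambda>n. - ((\<tau> * (1 / 2) ^ n)\<^sup>2)) \<longlonglongrightarrow> 0"
      by (auto intro!: tendsto_eq_intros LIMSEQ_power_zero)
    show "\<exists>N. \<forall>n\<ge>N. - ((\<tau> * (1 / 2) ^ n)\<^sup>2) \<le> coupling (s - f n)"
      using P s by (auto simp: P_def enlargement_def power_divide)
  qed
  then have "b + suminf g \<in> G" by (rule maximally_monotone_memI[OF G])
  then show thesis using dist by (intro that[of "b + suminf g"]) auto
qed

text \<open>Moving from \<open>b\<close> to a nearby graph point costs a term linear in
  \<open>norm (b - c)\<close>. Comparison with a fixed \<open>s0\<close> bounds that norm
  independently of \<tau>.\<close>

lemma type_NI_imp_quasidense:
  fixes G :: "('a::banach \<times> ('a \<Rightarrow>\<^sub>L real)) set"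
  assumes G: "maximally_monotone G" "G \<noteq> {}" and NI: "type_NI G"
  shows "quasidense G"
  unfolding quasidense_iff
proof (intro allI impI)
  fix c and \<epsilon> :: real assume \<epsilon>: "\<epsilon> > 0"
  obtain s0 where s0: "s0 \<in> G" using G by blast
  define N where "N = norm (s0 - c)"
  \<comment> \<open>Chosen so that the inequality \<open>quad\<close> fails for every norm above
    \<open>M\<close>.\<close>
  define M where "M = 2 * N + 2 + 2 * \<bar>coupling (s0 - c)\<bar>"
  have M: "M \<ge> 2" "N \<ge> 0" by (auto simp: M_def N_def)
  \<comment> \<open>The final error is at most \<open>(37 + 12 * M) * \<tau>\<close>; the cap at 1
    allows squares of \<tau> to be replaced by \<tau>.\<close>
  define \<tau> where "\<tau> = min 1 (\<epsilon> / (38 + 12 * M))"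
  have \<tau>: "0 < \<tau>" "\<tau> \<le> 1" using \<epsilon> M by (auto simp: \<tau>_def)
  have "\<tau> \<le> \<epsilon> / (38 + 12 * M)" by (simp add: \<tau>_def)
  then have \<tau>\<epsilon>: "(38 + 12 * M) * \<tau> \<le> \<epsilon>" using M by (simp add: field_simps)
  have \<tau>2: "\<tau>\<^sup>2 \<le> \<tau>" "0 < \<tau>\<^sup>2" using \<tau> by (auto simp: power2_eq_square mult_le_one)
  obtain b e where b: "b \<in> enlargement G e" "e + coupling (b - c) + (norm (b - c))\<^sup>2 / 2 < \<tau>\<^sup>2"
    using type_NI_enlargement_near[OF G(1) NI \<tau>2(2), of c] by blast
  define d where "d = b - c"
  have e: "e \<ge> 0" "e \<le> \<tau>\<^sup>2"
    using enlargement_nonneg[OF G(1) b(1)] b(2) abs_coupling_le[of "b - c"] by auto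
  have "- e \<le> coupling (s0 - b)" using b(1) s0 by (auto simp: enlargement_def)
  also have "s0 - b = (s0 - c) - d" by (simp add: d_def)
  finally have "- e \<le> coupling (s0 - c) - pairing (s0 - c) d + coupling d"
    by (simp only: coupling_diff)
  moreover have "\<bar>pairing (s0 - c) d\<bar> \<le> N * norm d" unfolding N_def by (rule abs_pairing_le)
  ultimately have quad: "(norm d)\<^sup>2 / 2 \<le> 1 + \<bar>coupling (s0 - c)\<bar> + N * norm d"
    using b(2) \<tau>(2) \<tau>2(1) unfolding d_def by linarith
  have dM: "norm d \<le> M"
  proof (rule ccontr)
    assume "\<not> norm d \<le> M"
    then have "M < norm d" by simp
    then have "norm d * (M / 2 - N) \<le> norm d * (norm d / 2 - N)" by (intro mult_left_mono) auto
    moreover have "M / 2 - N = 1 + \<bar>coupling (s0 - c)\<bar>" by (simp add: M_def field_simps)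
    moreover have "1 * (1 + \<bar>coupling (s0 - c)\<bar>) < norm d * (1 + \<bar>coupling (s0 - c)\<bar>)"
      using \<open>M < norm d\<close> M by (intro mult_strict_right_mono) auto
    ultimately show False using quad by (simp add: power2_eq_square algebra_simps)
  qed
  have "b \<in> enlargement G (\<tau>\<^sup>2)" using b(1) e(2) enlargement_mono by blast
  then obtain s where s: "s \<in> G" "norm (s - b) \<le> 6 * \<tau>"
    using type_NI_enlargement_close[OF G(1) NI \<tau>(1)] by blast
  define h where "h = s - b"
  have sc: "s - c = d + h" by (simp add: h_def d_def)
  have h: "norm h \<le> 6 * \<tau>" using s by (simp add: h_def)
  have dh: "norm d * norm h \<le> M * (6 * \<tau>)" using dM h M \<tau> by (intro mult_mono) auto
  have hh: "(norm h)\<^sup>2 \<le> 36 * \<tau>\<^sup>2" using power_mono[OF h, of 2] by (simp add: power_mult_distrib)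
  have "(norm (d + h))\<^sup>2 \<le> (norm d + norm h)\<^sup>2" by (intro power_mono norm_triangle_ineq) simp
  then have "(norm (d + h))\<^sup>2 / 2 \<le> (norm d)\<^sup>2 / 2 + norm d * norm h + (norm h)\<^sup>2 / 2"
    by (simp add: power2_sum)
  moreover have "coupling (d + h) \<le> coupling d + norm d * norm h + (norm h)\<^sup>2 / 2"
    using abs_pairing_le[of d h] abs_coupling_le[of h] unfolding coupling_add by linarith
  ultimately have "coupling (s - c) + (norm (s - c))\<^sup>2 / 2 < \<tau>\<^sup>2 + 12 * (M * \<tau>) + 36 * \<tau>\<^sup>2"
    using b(2) e(1) dh hh unfolding sc d_def[symmetric] by linarith
  also have "\<dots> \<le> (38 + 12 * M) * \<tau>" using \<tau>2 \<tau> by (simp add: algebra_simps)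
  finally show "\<exists>s\<in>G. coupling (s - c) + (norm (s - c))\<^sup>2 / 2 < \<epsilon>" using s(1) \<tau>\<epsilon> by (meson less_le_trans)
qed

text \<open>Young's inequality on \<open>y' s\<close> and \<open>w'' d\<close> splits the target
  into the quasidensity expression and the nearly minimized expression for \<open>y'\<close>, each
  contributing at most \<open>\<epsilon> / 2\<close>.\<close>

lemma quasidense_imp_type_NI:
  assumes "quasidense G"
  shows "type_NI G"
  unfolding type_NI_def
proof (intro allI impI)
  fix w' :: "'a \<Rightarrow>\<^sub>L real" and w'' :: "('a \<Rightarrow>\<^sub>L real) \<Rightarrow>\<^sub>L real" and \<epsilon> :: real
  assume \<epsilon>: "\<epsilon> > 0"
  obtain y' where y': "(norm y')\<^sup>2 / 2 + w'' y' \<le> - (norm w'')\<^sup>2 / 2 + \<epsilon> / 2"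
    using near_minimizer_norm_square[of "\<epsilon> / 2" w''] \<epsilon> by auto
  obtain s s' where s: "(s, s') \<in> G"
    "coupling ((s, s') - (0, w' - y')) + (norm ((s, s') - (0, w' - y')))\<^sup>2 / 2 < \<epsilon> / 2"
    using assms \<epsilon> unfolding quasidense_iff by (metis half_gt_zero surj_pair)
  define d where "d = s' - (w' - y')"
  have d: "s' - w' = d - y'" by (simp add: d_def)
  have "blinfun_apply d s + (norm s)\<^sup>2 / 2 + (norm d)\<^sup>2 / 2 < \<epsilon> / 2"
    using s(2) by (simp add: coupling_def norm_Pair d_def add_divide_distrib)
  moreover have "\<bar>y' s\<bar> \<le> norm y' * norm s" using norm_blinfun[of y' s] by simp
  moreover have "\<bar>w'' d\<bar> \<le> norm w'' * norm d" using norm_blinfun[of w'' d] by simp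
  moreover have "0 \<le> (norm y' - norm s)\<^sup>2" "0 \<le> (norm w'' - norm d)\<^sup>2" by simp_all
  ultimately have "blinfun_apply (canon s - w'') (d - y') < \<epsilon>"
    using y' by (simp add: blinfun.diff_left blinfun.diff_right power2_diff)
  then show "\<exists>p\<in>G. blinfun_apply (canon (fst p) - w'') (snd p - w') < \<epsilon>"
    using s(1) d by (intro bexI[of _ "(s, s')"]) simp_all
qed

section \<open>Negative infimum and type (FP)\<close>

lemma mem_UN_plusI: "x \<in> S \<Longrightarrow> y \<in> T \<Longrightarrow> z = x + y \<Longrightarrow> z \<in> (\<Union>x\<in>S. \<Union>y\<in>T. {x + y})"
  by blast

text \<open>Helly's theorem for a single functional: rescale a vector at which \<open>p\<close>
  attains at least half its norm.\<close>

lemma bidual_agrees_on_functional: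
  fixes p :: "'a::real_normed_vector \<Rightarrow>\<^sub>L real" and w'' :: "('a \<Rightarrow>\<^sub>L real) \<Rightarrow>\<^sub>L real"
  obtains w where "blinfun_apply p w = blinfun_apply w'' p" "norm w \<le> 2 * norm w''"
proof (cases "p = 0")
  case True then show ?thesis by (intro that[of 0]) auto
next
  case False
  then have "\<not> norm p \<le> norm p / 2" by simp
  then obtain x where x: "norm p / 2 * norm x < \<bar>p x\<bar>"
    using norm_blinfun_bound[of "norm p / 2" p]
    by (metis divide_nonneg_nonneg norm_ge_zero not_le real_norm_def zero_le_numeral)
  moreover have "0 \<le> norm p / 2 * norm x" by simp
  ultimately have px: "0 < \<bar>p x\<bar>" by linarith
  have "\<bar>w'' p\<bar> * norm x \<le> (norm w'' * norm p) * norm x"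
    using norm_blinfun[of w'' p] by (intro mult_right_mono) auto
  also have "\<dots> = 2 * norm w'' * (norm p / 2 * norm x)" by simp
  also have "\<dots> \<le> 2 * norm w'' * \<bar>p x\<bar>" using x by (intro mult_left_mono) auto
  finally have "\<bar>w'' p\<bar> / \<bar>p x\<bar> * norm x \<le> 2 * norm w''" using px by (simp add: field_simps)
  then show ?thesis using px
    by (intro that[of "(w'' p / p x) *\<^sub>R x"]) (auto simp: blinfun.scaleR_right)
qed

lemma type_FP_imp_type_NI:
  assumes FP: "type_FP G" and "G \<noteq> {}"
  shows "type_NI G"
proof (rule ccontr)
  assume "\<not> type_NI G"
  then obtain w' w'' \<delta> where \<delta>: "\<delta> > 0"
    and ge: "\<And>s s'. (s, s') \<in> G \<Longrightarrow> \<delta> \<le> blinfun_apply (canon s - w'') (s' - w')"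
    unfolding type_NI_def by (force simp: not_less)
  obtain s0 s0' where s0: "(s0, s0') \<in> G" using \<open>G \<noteq> {}\<close> by auto
  obtain w where w: "blinfun_apply (s0' - w') w = blinfun_apply w'' (s0' - w')" "norm w \<le> 2 * norm w''"
    using bidual_agrees_on_functional .
  \<comment> \<open>Off the segment the error is at most \<open>\<eta>\<close> times
    \<open>norm w'' + norm w\<close>, hence the factor 3; the added 1 avoids division by
    zero.\<close>
  define \<eta> where "\<eta> = \<delta> / (3 * norm w'' + 1)"
  have \<eta>: "\<eta> > 0" "\<eta> * (3 * norm w'') \<le> \<delta>"
    using \<delta> by (auto simp: \<eta>_def field_simps add_pos_nonneg)
  define U where "U = (\<Union>x\<in>closed_segment w' s0'. \<Union>y\<in>ball 0 \<eta>. {x + y})"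
  have "open U" unfolding U_def by (rule open_sums) simp
  moreover have "convex U" unfolding U_def by (intro convex_sums convex_closed_segment convex_ball)
  moreover have "w' \<in> U" unfolding U_def using \<eta> by (intro mem_UN_plusI[of w' _ 0]) auto
  moreover have "s0' \<in> U" unfolding U_def using \<eta> by (intro mem_UN_plusI[of s0' _ 0]) auto
  moreover from \<open>s0' \<in> U\<close> s0 have "U \<inter> range_mf G \<noteq> {}" by (force simp: range_mf_def)
  moreover have "0 \<le> blinfun_apply (s' - w') (s - w)" if s: "(s, s') \<in> G" and "s' \<in> U" for s s'
  proof -
    obtain t h where t: "0 \<le> t" "t \<le> 1" and h: "norm h < \<eta>"
      and s': "s' = (1 - t) *\<^sub>R w' + t *\<^sub>R s0' + h"
      using \<open>s' \<in> U\<close> by (auto simp: U_def in_segment)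
    then have s'w: "s' - w' = t *\<^sub>R (s0' - w') + h" by (simp add: algebra_simps)
    have "blinfun_apply w'' (s' - w') - blinfun_apply (s' - w') w
        = t * (blinfun_apply w'' (s0' - w') - blinfun_apply (s0' - w') w) + (blinfun_apply w'' h - blinfun_apply h w)"
      unfolding s'w by (simp add: coupling_simps algebra_simps)
    also have "\<dots> = blinfun_apply w'' h - blinfun_apply h w" using w(1) by simp
    finally have eq: "blinfun_apply w'' (s' - w') - blinfun_apply (s' - w') w
        = blinfun_apply w'' h - blinfun_apply h w" .
    have "\<bar>blinfun_apply w'' h\<bar> \<le> norm w'' * norm h" "\<bar>blinfun_apply h w\<bar> \<le> norm h * norm w"
      using norm_blinfun[of w'' h] norm_blinfun[of h w] by auto
    moreover have "norm w'' * norm h \<le> norm w'' * \<eta>" using h by (intro mult_left_mono) auto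
    moreover have "norm h * norm w \<le> \<eta> * (2 * norm w'')" using h w(2) \<eta> by (intro mult_mono) auto
    ultimately have "- \<delta> \<le> blinfun_apply w'' (s' - w') - blinfun_apply (s' - w') w"
      unfolding eq using \<eta>(2) by (simp add: algebra_simps)
    then show ?thesis using ge[OF s]
      by (simp add: blinfun.diff_left[of "canon s"] blinfun.diff_right[of "s' - w'"])
  qed
  ultimately have "(w, w') \<in> G"
    using FP unfolding type_FP_def by blast
  \<comment> \<open>At \<open>(w, w')\<close> the functional is evaluated at zero, so the margin
    would give \<open>\<delta> \<le> 0\<close>.\<close>
  then show False using ge \<delta> by fastforce
qed

text \<open>The right-hand side of the hypothesis is the support function, on the predual, of the set in
  the conclusion, which is weak* compact.\<close>
lemma mem_segment_plus_cball:
  fixes v p :: "'a::real_normed_vector \<Rightarrow>\<^sub>L real"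
  assumes \<eta>: "\<eta> \<ge> 0" and le: "\<And>z. v z \<le> max 0 (p z) + \<eta> * norm z"
  obtains t h where "0 \<le> t" "t \<le> 1" "norm h \<le> \<eta>" "v = t *\<^sub>R p + h"
proof -
  define A where "A = {(z, a). max 0 (p z) \<le> a}"
  \<comment> \<open>A linear \<open>l\<close> between \<open>max 0 p\<close> and
    \<open>v - \<eta> * norm\<close> vanishes where \<open>p\<close> does, so it is a multiple of
    \<open>p\<close> with factor in the unit interval; the remainder \<open>v - l\<close> has norm
    at most \<eta>.\<close>
  define B where "B = {(z, b). b \<le> v z - \<eta> * norm z}"
  have "convex A"
  proof -
    have "A = {(z, a). 0 \<le> a} \<inter> {(z, a). p z \<le> a}" by (auto simp: A_def)
    moreover have "convex {(z::'a, a::real). 0 \<le> a}" by (rule convexI) auto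
    moreover have "convex {(z, a). p z \<le> a}"
      by (rule convexI) (auto simp: blinfun.add_right blinfun.scaleR_right intro!: add_mono mult_left_mono)
    ultimately show ?thesis by (simp add: convex_Int)
  qed
  moreover have "convex B"
  proof (rule convexI, clarsimp simp: B_def)
    fix z z' :: 'a and b b' s t :: real
    assume st: "0 \<le> s" "0 \<le> t" "s + t = 1"
      and b: "b \<le> v z - \<eta> * norm z" "b' \<le> v z' - \<eta> * norm z'"
    have "s * b + t * b' \<le> s * (v z - \<eta> * norm z) + t * (v z' - \<eta> * norm z')"
      using st b by (intro add_mono mult_left_mono)
    moreover have "\<eta> * norm (s *\<^sub>R z + t *\<^sub>R z') \<le> \<eta> * (s * norm z + t * norm z')"
      using st \<eta> norm_triangle_ineq[of "s *\<^sub>R z" "t *\<^sub>R z'"] by (intro mult_left_mono) auto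
    ultimately show "s * b + t * b' \<le> v (s *\<^sub>R z + t *\<^sub>R z') - \<eta> * norm (s *\<^sub>R z + t *\<^sub>R z')"
      by (simp add: blinfun.add_right blinfun.scaleR_right algebra_simps)
  qed
  moreover have "b \<le> a" if "(z, a) \<in> A" "(z, b) \<in> B" for z a b
    using that le[of z] by (auto simp: A_def B_def)
  moreover have "(0, 0) \<in> A" by (simp add: A_def)
  moreover have "(z, - (norm v + \<eta>)) \<in> B" if "norm (z - 0) \<le> 1" for z
    using norm_blinfun[of v z] mult_left_mono[of "norm z" 1 "norm v"] mult_left_mono[of "norm z" 1 \<eta>] that \<eta>
    by (simp add: B_def)
  ultimately obtain l k where lA: "\<And>z a. (z, a) \<in> A \<Longrightarrow> blinfun_apply l z + k \<le> a"
    and lB: "\<And>z b. (z, b) \<in> B \<Longrightarrow> b \<le> blinfun_apply l z + k"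
    using convex_sandwich[of A B 0 0 1] by (metis zero_less_one)
  have k: "k = 0" using lA[of 0 0] lB[of 0 0] by (simp add: A_def B_def)
  have l_le: "l z \<le> max 0 (p z)" for z using lA[of z "max 0 (p z)"] k by (simp add: A_def)
  have l_ge: "v z - \<eta> * norm z \<le> l z" for z using lB[of z "v z - \<eta> * norm z"] k by (simp add: B_def)
  have l0: "l z = 0" if "p z = 0" for z
    using l_le[of z] l_le[of "- z"] that by (simp add: blinfun.minus_right)
  obtain t where t: "0 \<le> t" "t \<le> 1" "l = t *\<^sub>R p"
  proof (cases "p = 0")
    case True
    then have "l = 0" using l0 by (intro blinfun_eqI) auto
    then show ?thesis using that[of 0] by simp
  next
    case False
    then obtain x where x: "p x \<noteq> 0" by (metis blinfun_eqI blinfun.zero_left)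
    define z0 where "z0 = (1 / p x) *\<^sub>R x"
    have z0: "p z0 = 1" using x by (simp add: z0_def blinfun.scaleR_right)
    have "l z = (l z0 *\<^sub>R p) z" for z
      using l0[of "z - p z *\<^sub>R z0"] z0
      by (simp add: blinfun.diff_right blinfun.scaleR_right blinfun.scaleR_left mult.commute)
    then have "l = l z0 *\<^sub>R p" by (rule blinfun_eqI)
    moreover have "0 \<le> l z0" "l z0 \<le> 1"
      using l_le[of z0] l_le[of "- z0"] z0 by (auto simp: blinfun.minus_right)
    ultimately show ?thesis using that by blast
  qed
  have "norm (v - l) \<le> \<eta>"
  proof (rule norm_blinfun_bound[OF \<eta>])
    fix z show "norm ((v - l) z) \<le> \<eta> * norm z"
      using l_ge[of z] l_ge[of "- z"] by (simp add: blinfun.diff_left blinfun.minus_right abs_le_iff)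
  qed
  then show thesis using t by (intro that[of t "v - l"]) auto
qed

lemma nonpos_of_scaled_bounded:
  fixes D C :: real
  assumes "\<And>t. t > 0 \<Longrightarrow> t * D \<le> C"
  shows "D \<le> 0"
proof (rule ccontr)
  assume "\<not> D \<le> 0"
  then have "(\<bar>C\<bar> + 1) / D * D \<le> C" by (intro assms) auto
  then show False using \<open>\<not> D \<le> 0\<close> by simp
qed

text \<open>This is the quasidensity argument for the inverse of the sum of the inverse of S and the
  normal cone of K.\<close>
lemma type_NI_localized_near:
  fixes p :: "'a::real_normed_vector \<Rightarrow>\<^sub>L real" and \<eta> :: real
  defines "K \<equiv> (\<Union>x\<in>closed_segment 0 p. \<Union>y\<in>cball 0 \<eta>. {x + y})"
  assumes G: "maximally_monotone G" and NI: "type_NI G" and \<epsilon>: "\<epsilon> > 0" and \<eta>: "\<eta> > 0"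
    and s0: "s0 \<in> G" and p: "p = snd (s0 - c)"
  obtains u z y' a where "y' \<in> K" "((u, y'), a) \<in> fitzpatrick_epi G c"
    "a + (max 0 (p z) + \<eta> * norm z) + (norm (u + z))\<^sup>2 / 2 + (norm y')\<^sup>2 / 2 < \<epsilon>"
proof -
  define F where "F = fitzpatrick_epi G c"
  \<comment> \<open>The support function of \<open>K\<close> on the predual.\<close>
  define \<sigma> where "\<sigma> z = max 0 (p z) + \<eta> * norm z" for z
  \<comment> \<open>Adding epigraphs in the first variable only makes \<open>A\<close> an
    inf-convolution with \<open>\<sigma>\<close>, after the dual variable is restricted to
    \<open>K\<close>.\<close>
  define T where "T = (\<lambda>(((u::'a, y'::'a \<Rightarrow>\<^sub>L real), a::real), (z::'a, a'::real)). ((u + z, y'), a + a'))"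
  define FK where "FK = F \<inter> {x. snd (fst x) \<in> K}"
  define A where "A = T ` (FK \<times> {(z, a'). \<sigma> z \<le> a'})"
  have convK: "convex K" unfolding K_def by (intro convex_sums convex_closed_segment convex_cball)
  have pK: "p \<in> K" unfolding K_def using \<eta> by (intro mem_UN_plusI[of p _ 0]) auto
  have "linear T" by (rule linearI) (auto simp: T_def algebra_simps)
  moreover have "convex FK"
  proof -
    have "convex ((snd \<circ> fst) -` K :: (('a \<times> ('a \<Rightarrow>\<^sub>L real)) \<times> real) set)"
      using convK by (intro convex_linear_vimage linear_compose linear_fst linear_snd)
    then show ?thesis unfolding FK_def F_def vimage_def comp_def
      by (intro convex_Int convex_fitzpatrick_epi)
  qed
  moreover have "convex {(z, a'). \<sigma> z \<le> a'}"
  proof (rule convexI, clarsimp)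
    fix z z' :: 'a and b b' s t :: real
    assume st: "0 \<le> s" "0 \<le> t" "s + t = 1" and b: "\<sigma> z \<le> b" "\<sigma> z' \<le> b'"
    have m: "s * max 0 (p z) \<ge> s * p z" "t * max 0 (p z') \<ge> t * p z'"
      "s * max 0 (p z) \<ge> 0" "t * max 0 (p z') \<ge> 0"
      using st by (auto intro: mult_left_mono)
    have "\<eta> * norm (s *\<^sub>R z + t *\<^sub>R z') \<le> \<eta> * (s * norm z + t * norm z')"
      using st \<eta> norm_triangle_ineq[of "s *\<^sub>R z" "t *\<^sub>R z'"] by (intro mult_left_mono) auto
    then have "\<sigma> (s *\<^sub>R z + t *\<^sub>R z') \<le> s * \<sigma> z + t * \<sigma> z'"
      using m by (simp add: \<sigma>_def blinfun.add_right blinfun.scaleR_right algebra_simps)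
    also have "\<dots> \<le> s * b + t * b'" using st b by (intro add_mono mult_left_mono)
    finally show "\<sigma> (s *\<^sub>R z + t *\<^sub>R z') \<le> s * b + t * b'" .
  qed
  ultimately have convA: "convex A" unfolding A_def by (intro convex_linear_image convex_Times)
  have A_I: "((u + z, y'), a + a') \<in> A" if "((u, y'), a) \<in> F" "y' \<in> K" "\<sigma> z \<le> a'" for u y' a z a'
    unfolding A_def T_def FK_def using that by force
  have A_E: "\<exists>u z a1. x = u + z \<and> ((u, y'), a1) \<in> F \<and> y' \<in> K \<and> a1 + \<sigma> z \<le> a"
    if "((x, y'), a) \<in> A" for x y' a
    using that unfolding A_def T_def FK_def by force
  have s0F: "((fst (s0 - c), p), coupling (s0 - c)) \<in> F"
    using graph_in_fitzpatrick_epi[OF G s0, of c] by (simp only: F_def p prod.collapse)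
  have dual: "\<exists>y y' a. ((y, y'), a) \<in> A \<and>
      a < blinfun_apply v' y + blinfun_apply v'' y' - blinfun_apply v'' v' + \<delta>"
    if \<delta>: "\<delta> > 0" for v' v'' \<delta>
  proof (rule ccontr)
    assume "\<not> ?thesis"
    then have ge: "v' (u + z) + v'' y' - v'' v' + \<delta> \<le> a + \<sigma> z"
      if "((u, y'), a) \<in> F" "y' \<in> K" for u y' a z
      using A_I[OF that order_refl, of z] by force
    \<comment> \<open>The inequality \<open>ge\<close> holds for all multiples of \<open>z\<close>,
      so its linear growth in \<open>z\<close> must be nonpositive.\<close>
    have v'_le: "v' z \<le> max 0 (p z) + \<eta> * norm z" for z
    proof -
      have "t * (v' z - \<sigma> z) \<le> coupling (s0 - c) - v' (fst (s0 - c)) - v'' p + v'' v' - \<delta>" if "t > 0" for t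
      proof -
        have "\<sigma> (t *\<^sub>R z) = t * \<sigma> z" using that
          by (simp add: \<sigma>_def blinfun.scaleR_right max_mult_distrib_left distrib_left)
        then show ?thesis using ge[OF s0F pK, of "t *\<^sub>R z"]
          by (simp add: blinfun.add_right blinfun.diff_right blinfun.scaleR_right algebra_simps)
      qed
      then have "v' z - \<sigma> z \<le> 0" by (rule nonpos_of_scaled_bounded)
      then show ?thesis by (simp add: \<sigma>_def)
    qed
    obtain t h where "0 \<le> t" "t \<le> 1" "norm h \<le> \<eta>" "v' = t *\<^sub>R p + h"
      using mem_segment_plus_cball[OF less_imp_le[OF \<eta>] v'_le] by blast
    then have v'K: "v' \<in> K" unfolding K_def
      by (intro mem_UN_plusI[of "t *\<^sub>R p" _ h]) (auto simp: in_segment)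
    \<comment> \<open>A second sandwich trades the constraint \<open>y' \<in> K\<close> for a
      functional \<open>l2\<close> on the dual. The ball of radius \<eta> around \<open>p\<close>
      lies in \<open>K\<close> and supplies the required interior.\<close>
    define A1 where "A1 = (\<lambda>((u, y'), a). ((u, y'), a - v' u - v'' y')) ` F"
    define B1 where "B1 = {((u::'a, y'), b). y' \<in> K \<and> b \<le> \<delta> - v'' v'}"
    have "linear (\<lambda>((u, y'), a). ((u, y'), a - v' u - v'' y'))"
      by (rule linearI) (auto simp: blinfun.add_right blinfun.scaleR_right algebra_simps)
    then have "convex A1" unfolding A1_def F_def by (rule convex_linear_image[OF _ convex_fitzpatrick_epi])
    moreover have "convex B1"
    proof -
      have "B1 = (snd \<circ> fst) -` K \<inter> snd -` {..\<delta> - v'' v'}" by (auto simp: B1_def)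
      also have "convex \<dots>" using convK
        by (intro convex_Int convex_linear_vimage linear_compose linear_fst linear_snd convex_real_interval)
      finally show ?thesis .
    qed
    moreover have "b \<le> a" if "(x, a) \<in> A1" "(x, b) \<in> B1" for x a b
      using that ge[of _ _ _ 0] by (force simp: A1_def B1_def \<sigma>_def)
    moreover have "((fst (s0 - c), p), coupling (s0 - c) - v' (fst (s0 - c)) - v'' p) \<in> A1"
      unfolding A1_def using s0F by force
    moreover have "(x, \<delta> - v'' v') \<in> B1" if "norm (x - (fst (s0 - c), p)) \<le> \<eta>" for x
    proof -
      obtain u y' where x: "x = (u, y')" by (cases x)
      have "norm (y' - p) \<le> \<eta>" using that norm_snd_le[of "y' - p" "u - fst (s0 - c)"] by (simp add: x)
      then have "y' \<in> K" unfolding K_def by (intro mem_UN_plusI[of p _ "y' - p"]) auto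
      then show ?thesis by (simp add: B1_def x)
    qed
    ultimately obtain l k where lA: "\<And>x a. (x, a) \<in> A1 \<Longrightarrow> blinfun_apply l x + k \<le> a"
      and lB: "\<And>x b. (x, b) \<in> B1 \<Longrightarrow> b \<le> blinfun_apply l x + k"
      using convex_sandwich[of A1 B1, OF _ _ _ _ \<eta>] by metis
    obtain l1 l2 where l: "\<And>y y'. blinfun_apply l (y, y') = blinfun_apply l1 y + blinfun_apply l2 y'"
      using blinfun_prod_split[of l] by blast
    \<comment> \<open>\<open>B1\<close> leaves the first component free, and a linear functional
      bounded below on a whole space is zero.\<close>
    have l1: "l1 u = 0" for u
    proof -
      have "l1 w \<le> 0" for w
      proof (rule nonpos_of_scaled_bounded)
        fix t :: real
        have "\<delta> - v'' v' \<le> l (- (t *\<^sub>R w), v') + k" using lB v'K by (simp add: B1_def)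
        then show "t * l1 w \<le> l2 v' + k - (\<delta> - v'' v')"
          by (simp add: l blinfun.minus_right blinfun.scaleR_right)
      qed
      from this[of u] this[of "- u"] show ?thesis by (simp add: blinfun.minus_right)
    qed
    have k: "\<delta> - v'' v' \<le> l2 v' + k" using lB[of "(0, v')" "\<delta> - v'' v'"] v'K by (simp add: B1_def l)
    \<comment> \<open>Negative infimum at \<open>v'' + l2\<close> sees the whole graph; the
      correction \<open>l2\<close> carries the restriction to \<open>K\<close>.\<close>
    obtain s where s: "s \<in> G" "coupling (s - c) < blinfun_apply v' (fst (s - c))
        + blinfun_apply (v'' + l2) (snd (s - c)) - blinfun_apply (v'' + l2) v' + \<delta>"
      using type_NI_coupling[OF NI \<delta>] .
    have "(s - c, coupling (s - c)) \<in> F" unfolding F_def by (rule graph_in_fitzpatrick_epi[OF G s(1)])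
    then have "(s - c, coupling (s - c) - v' (fst (s - c)) - v'' (snd (s - c))) \<in> A1"
      unfolding A1_def by (force simp: image_iff split_beta)
    from lA[OF this] have "l (s - c) + k \<le> coupling (s - c) - v' (fst (s - c)) - v'' (snd (s - c))" .
    moreover have "l (s - c) = l2 (snd (s - c))"
      using l[of "fst (s - c)" "snd (s - c)"] by (simp only: prod.collapse l1 add_0)
    ultimately show False using s(2) k by (simp add: blinfun.add_left)
  qed
  have "A \<noteq> {}" using A_I[OF s0F pK order_refl] by blast
  obtain x1 y' a where A: "((x1, y'), a) \<in> A" "a + (norm (x1, y'))\<^sup>2 / 2 < \<epsilon>"
    using infimum_plus_norm_square_le[OF convA \<open>A \<noteq> {}\<close> \<epsilon> dual] by (metis surj_pair)
  obtain u z a1 where x1: "x1 = u + z" "((u, y'), a1) \<in> F" "y' \<in> K" "a1 + \<sigma> z \<le> a"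
    using A_E[OF A(1)] by blast
  show thesis
  proof (rule that[OF x1(3) x1(2)[unfolded F_def]])
    show "a1 + (max 0 (p z) + \<eta> * norm z) + (norm (u + z))\<^sup>2 / 2 + (norm y')\<^sup>2 / 2 < \<epsilon>"
      using A(2) x1(1,4) by (simp add: norm_Pair \<sigma>_def add_divide_distrib)
  qed
qed

text \<open>Maximality makes the graph an intersection of conditions that are closed by continuity
  of \<open>coupling\<close>.\<close>

lemma maximally_monotone_closed:
  assumes G: "maximally_monotone G"
  shows "closed G"
proof -
  have "G = (\<Inter>s\<in>G. {b. 0 \<le> coupling (s - b)})"
    using maximally_monotone_memI[OF G] maximally_monotone_coupling_nonneg[OF G] by blast
  moreover have "closed {b. 0 \<le> coupling (s - b)}" for s :: "'a \<times> ('a \<Rightarrow>\<^sub>L real)"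
    by (intro closed_Collect_le continuous_intros)
  ultimately show ?thesis by (metis (no_types, lifting) closed_INT)
qed

text \<open>The localized estimate gives graph points over \<open>U\<close>. There the assumed
  relation bounds \<open>coupling (s - c)\<close> below, which forces them towards \<open>c\<close>;
  closedness of the graph finishes.\<close>

lemma type_NI_imp_type_FP:
  fixes G :: "('a::banach \<times> ('a \<Rightarrow>\<^sub>L real)) set"
  assumes G: "maximally_monotone G" and NI: "type_NI G"
  shows "type_FP G"
  unfolding type_FP_def
proof (intro conjI allI impI)
  show "monotone_mf G" using G by (simp add: maximally_monotone_def)
next
  fix U w w'
  assume asm: "open U \<and> convex U \<and> U \<inter> range_mf G \<noteq> {} \<and> w' \<in> U \<and>
     (\<forall>(s, s')\<in>G. s' \<in> U \<longrightarrow> 0 \<le> blinfun_apply (s' - w') (s - w))"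
  obtain s0 where s0: "s0 \<in> G" "snd s0 \<in> U" using asm by (auto simp: range_mf_def)
  define c where "c = (w, w')"
  define p where "p = snd (s0 - c)"
  have rel: "0 \<le> coupling (s - c)" if "s \<in> G" "snd s \<in> U" for s
    using asm that by (auto simp: coupling_def c_def split: prod.splits)
  obtain \<rho>1 \<rho>2 where \<rho>12: "\<rho>1 > 0" "\<rho>2 > 0" "ball w' \<rho>1 \<subseteq> U" "ball (snd s0) \<rho>2 \<subseteq> U"
    using asm s0 by (meson open_contains_ball)
  define \<rho> where "\<rho> = min \<rho>1 \<rho>2"
  have \<rho>: "\<rho> > 0" "ball w' \<rho> \<subseteq> U" "ball (snd s0) \<rho> \<subseteq> U"
    using \<rho>12 by (auto simp: \<rho>_def)
  have in_U: "w' + (t *\<^sub>R p + h) \<in> U" if "0 \<le> t" "t \<le> 1" "norm h < \<rho>" for t h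
  proof -
    have "w' + h \<in> U" "snd s0 + h \<in> U" using that \<rho> by (auto simp: subset_iff dist_norm)
    then have "(1 - t) *\<^sub>R (w' + h) + t *\<^sub>R (snd s0 + h) \<in> U"
      using asm that by (intro convexD) auto
    also have "(1 - t) *\<^sub>R (w' + h) + t *\<^sub>R (snd s0 + h) = w' + (t *\<^sub>R p + h)"
      by (simp add: p_def c_def algebra_simps)
    finally show ?thesis .
  qed
  \<comment> \<open>Half of \<rho> leaves room for the displacement to a graph point, which is at
    most \<open>\<eta> / 2\<close>.\<close>
  define \<eta> where "\<eta> = \<rho> / 2"
  have \<eta>: "\<eta> > 0" using \<rho> by (simp add: \<eta>_def)
  have near: "\<exists>s\<in>G. norm (s - c) \<le> 62 * \<tau>" if \<tau>: "0 < \<tau>" "12 * \<tau> \<le> \<eta>" for \<tau>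
  proof -
    have \<tau>2: "\<tau>\<^sup>2 > 0" using \<tau> by simp
    obtain u z y' a where y': "y' \<in> (\<Union>x\<in>closed_segment 0 p. \<Union>y\<in>cball 0 \<eta>. {x + y})"
      and a: "((u, y'), a) \<in> fitzpatrick_epi G c"
      and lt: "a + (max 0 (p z) + \<eta> * norm z) + (norm (u + z))\<^sup>2 / 2 + (norm y')\<^sup>2 / 2 < \<tau>\<^sup>2"
      by (rule type_NI_localized_near[OF G NI \<tau>2 \<eta> s0(1) p_def])
    obtain t h where t: "0 \<le> t" "t \<le> 1" and h: "norm h \<le> \<eta>" and y'_eq: "y' = t *\<^sub>R p + h"
      using y' by (auto simp: in_segment)
    define d where "d = (u, y')"
    define e where "e = a - coupling d"
    have b: "c + d \<in> enlargement G e"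
      using a by (simp add: fitzpatrick_epi_iff_enlargement d_def e_def)
    have e0: "e \<ge> 0" by (rule enlargement_nonneg[OF G b])
    have cd: "coupling d = y' u" by (simp add: coupling_def d_def)
    \<comment> \<open>As \<open>y'\<close> lies in \<open>K\<close>, its value at \<open>z\<close>
      is at most the support function, so the penalty pays for replacing \<open>u + z\<close> by
      \<open>u\<close>.\<close>
    have "t * p z \<le> t * max 0 (p z)" using t by (intro mult_left_mono) auto
    also have "\<dots> \<le> 1 * max 0 (p z)" using t by (intro mult_right_mono) auto
    finally have "t * p z \<le> max 0 (p z)" by simp
    moreover have "h z \<le> \<eta> * norm z"
      using norm_blinfun[of h z] mult_right_mono[OF h norm_ge_zero[of z]] by simp
    ultimately have "y' z \<le> max 0 (p z) + \<eta> * norm z"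
      by (simp add: y'_eq blinfun.add_left blinfun.scaleR_left)
    moreover have "- ((norm (u + z))\<^sup>2 / 2 + (norm y')\<^sup>2 / 2) \<le> y' u + y' z"
      using abs_coupling_le[of "(u + z, y')"]
      by (simp add: coupling_def norm_Pair blinfun.add_right add_divide_distrib)
    ultimately have "e \<le> \<tau>\<^sup>2" using lt by (simp add: e_def cd)
    then have "c + d \<in> enlargement G (\<tau>\<^sup>2)" using b enlargement_mono by blast
    then obtain s where s: "s \<in> G" "norm (s - (c + d)) \<le> 6 * \<tau>"
      using type_NI_enlargement_close[OF G NI \<tau>(1)] by blast
    define k where "k = s - (c + d)"
    have k: "norm k \<le> 6 * \<tau>" using s by (simp add: k_def)
    have sc: "s - c = d + k" by (simp add: k_def)
    have "snd s = w' + (t *\<^sub>R p + (h + snd k))"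
      by (simp add: k_def c_def d_def y'_eq)
    moreover have "norm (h + snd k) < \<rho>"
      using norm_triangle_ineq[of h "snd k"] h k norm_snd_le[of "snd k" "fst k"] \<tau> \<rho>(1)
      unfolding \<eta>_def prod.collapse by linarith
    ultimately have "snd s \<in> U" using in_U[OF t] by metis
    then have "0 \<le> coupling d + pairing d k + coupling k"
      using rel[OF s(1)] unfolding sc coupling_add by simp
    define X Y Z where XYZ: "X = norm (u + z)" "Y = norm y'" "Z = norm z"
    have "norm u \<le> X + Z" using norm_triangle_ineq4[of "u + z" z] by (simp add: XYZ)
    then have d: "norm d \<le> X + Y + Z"
      using norm_Pair_le[of u y'] by (simp add: d_def XYZ)
    have "\<bar>pairing d k\<bar> \<le> norm d * norm k" by (rule abs_pairing_le)
    also have "\<dots> \<le> (X + Y + Z) * (6 * \<tau>)" using d k by (intro mult_mono) (auto simp: XYZ)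
    finally have "\<bar>pairing d k\<bar> \<le> 6 * \<tau> * X + 6 * \<tau> * Y + 6 * \<tau> * Z" by (simp add: algebra_simps)
    \<comment> \<open>Only half of the penalty \<open>\<eta> * Z\<close> is spent here; the other
      half later bounds \<open>Z\<close>.\<close>
    moreover have "6 * \<tau> * Z \<le> \<eta> / 2 * Z" using \<tau> by (intro mult_right_mono) (auto simp: XYZ)
    moreover have "\<bar>coupling k\<bar> \<le> 18 * \<tau>\<^sup>2"
      using abs_coupling_le[of k] power_mono[OF k, of 2] by (simp add: power_mult_distrib)
    ultimately have cd_ge: "- (6 * \<tau> * X + 6 * \<tau> * Y + \<eta> / 2 * Z + 18 * \<tau>\<^sup>2) \<le> coupling d"
      using \<open>0 \<le> coupling d + pairing d k + coupling k\<close> by linarith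
    have "\<eta> * Z + X\<^sup>2 / 2 + Y\<^sup>2 / 2 < \<tau>\<^sup>2 - coupling d"
      using lt e0 unfolding e_def XYZ by linarith
    moreover have "6 * \<tau> * X \<le> X\<^sup>2 / 4 + 36 * \<tau>\<^sup>2" "6 * \<tau> * Y \<le> Y\<^sup>2 / 4 + 36 * \<tau>\<^sup>2"
      using zero_le_power2[of "X / 2 - 6 * \<tau>"] zero_le_power2[of "Y / 2 - 6 * \<tau>"]
      by (simp_all add: power2_diff power_mult_distrib power_divide algebra_simps)
    \<comment> \<open>The constant 91 is \<open>1 + 18 + 36 + 36\<close>. It yields the bounds 20,
      20 and 16 for \<open>X\<close>, \<open>Y\<close> and \<open>Z\<close>, and 6 more for
      \<open>k\<close> make 62.\<close>
    ultimately have tot: "\<eta> * Z / 2 + X\<^sup>2 / 4 + Y\<^sup>2 / 4 \<le> 91 * \<tau>\<^sup>2"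
      using cd_ge by (simp add: field_simps)
    have nn: "0 \<le> \<eta> * Z" "0 \<le> X\<^sup>2" "0 \<le> Y\<^sup>2" "0 \<le> \<tau>\<^sup>2" using \<eta> by (auto simp: XYZ)
    have "(20 * \<tau>)\<^sup>2 = 400 * \<tau>\<^sup>2" by (simp add: power_mult_distrib)
    then have "X\<^sup>2 \<le> (20 * \<tau>)\<^sup>2" "Y\<^sup>2 \<le> (20 * \<tau>)\<^sup>2" using tot nn by linarith+
    then have X: "X \<le> 20 * \<tau>" and Y: "Y \<le> 20 * \<tau>"
      using \<tau> power2_le_imp_le[of X "20 * \<tau>"] power2_le_imp_le[of Y "20 * \<tau>"] by auto
    have "12 * \<tau> * Z \<le> \<eta> * Z" using \<tau> by (intro mult_right_mono) (auto simp: XYZ)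
    then have "12 * \<tau> * Z \<le> 192 * \<tau>\<^sup>2" using tot nn by linarith
    then have "\<tau> * (12 * Z) \<le> \<tau> * (192 * \<tau>)" by (simp add: power2_eq_square algebra_simps)
    then have "Z \<le> 16 * \<tau>" using \<tau> by (simp only: mult_le_cancel_left_pos)
    then have "norm (s - c) \<le> 62 * \<tau>"
      using norm_triangle_ineq[of d k] d k X Y unfolding sc by linarith
    then show ?thesis using s(1) by blast
  qed
  have "c \<in> closure G"
    unfolding closure_approachable
  proof (intro allI impI)
    fix r :: real assume r: "r > 0"
    define \<tau> where "\<tau> = min (\<eta> / 12) (r / 63)"
    have "0 < \<tau>" "12 * \<tau> \<le> \<eta>" "62 * \<tau> < r" using r \<eta> by (auto simp: \<tau>_def min_def)
    then show "\<exists>s\<in>G. dist s c < r" using near[of \<tau>] by (metis dist_norm le_less_trans)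
  qed
  then show "(w, w') \<in> G" using maximally_monotone_closed[OF G] by (simp add: c_def)
qed

theorem theorem8p3:
  fixes G :: "('a::banach \<times> ('a \<Rightarrow>\<^sub>L real)) set"
  assumes "\<exists>x::'a. x \<noteq> 0"
    and "G \<noteq> {}"
    and "maximally_monotone G"
  shows "(quasidense G \<longleftrightarrow> type_FP G) \<and>
         (type_FP G \<longleftrightarrow>
           (\<forall>(w' :: 'a \<Rightarrow>\<^sub>L real) (w'' :: ('a \<Rightarrow>\<^sub>L real) \<Rightarrow>\<^sub>L real).
              (INF p\<in>G. ereal (blinfun_apply (canon (fst p) - w'') (snd p - w'))) \<le> 0))"
  \<comment> \<open>Now (c) is literally \<open>type_NI G\<close>, to which each of the other
    conditions is equivalent.\<close>
  unfolding INF_ereal_le_zero_iff type_NI_def[symmetric]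
  using assms(2,3) type_NI_imp_quasidense quasidense_imp_type_NI type_NI_imp_type_FP type_FP_imp_type_NI
  by blast

end
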